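(* If $\mathcal{P}$ is an order-hereditary property of $k$-colourings of (the edges of) the sequence of hypercube graphs $\mathbf{Q}=(Q_n)_{n\in\mathbb{N}}$, with $\mathcal{P}_n\ne\emptyset$ for every $n$, then $$|\mathcal{P}_n|=k^{\left(\pi^{\mathbf{Q}}(\mathcal{P})+o(1)\right)2^{n-1}n}\qquad(n\to\infty).$$
   Context: $k\ge2$ is a fixed integer, $[k]=\{1,\dots,k\}$. $Q_n$ is the $n$-dimensional hypercube graph on vertex set $\{0,1\}^n$, with two vertices adjacent iff they differ in exactly one coordinate; $e(Q_n)=n2^{n-1}$. For $m\le n$, an order-preserving embedding of $Q_m$ into $Q_n$ is a map $\phi:\{0,1\}^m\to\{0,1\}^n$ for which there is an $m$-set $B=\{b_1<\dots<b_m\}\subseteq[n]$ such that $\phi(\mathbf{x})_{b_j}=\mathbf{x}_j$ for all $j$, and $\phi(\mathbf{x})_i=\phi(\mathbf{0})_i$ for $i\notin B$. An order-hereditary property of $k$-colourings of $\mathbf{Q}$ is a sequence $\mathcal{P}=(\mathcal{P}_n)_n$, where $\mathcal{P}_n$ is a set of maps $c:E(Q_n)\to[k]$, such that for every $c\in\mathcal{P}_n$ and every order-preserving embedding $\phi:Q_m\to Q_n$, the colouring $\mathbf{x}\mathbf{y}\mapsto c(\phi(\mathbf{x})\phi(\mathbf{y}))$ of $E(Q_m)$ lies in $\mathcal{P}_m$. A template for $Q_n$ is a function $t$ assigning to each edge $e$ of $Q_n$ a nonempty set $t(e)\subseteq[k]$; $\langle t\rangle$ is the set of $c:E(Q_n)\to[k]$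 with $c(e)\in t(e)$ for all $e$; $\mathrm{Ent}(t)=\sum_{e\in E(Q_n)}\log_k|t(e)|$. $\mathrm{ex}(Q_n,\mathcal{P})=\max\{\mathrm{Ent}(t):\langle t\rangle\subseteq\mathcal{P}_n\}$, and $\pi^{\mathbf{Q}}(\mathcal{P})=\lim_{n\to\infty}\mathrm{ex}(Q_n,\mathcal{P})/(n2^{n-1})$ (the limit exists). *)

theory Defs
  imports "HOL-Analysis.Analysis" "HOL-Library.Landau_Symbols"
begin

definition cube_verts :: "nat \<Rightarrow> (nat \<Rightarrow> nat) set" where
  "cube_verts n = {1..n} \<rightarrow>\<^sub>E {0, 1}"

definition cube_edges :: "nat \<Rightarrow> (nat \<Rightarrow> nat) set set" where
  "cube_edges n =
     {{x, y} | x y. x \<in> cube_verts n \<and> y \<in> cube_verts n \<and> card {i \<in> {1..n}. x i \<noteq> y i} = 1}"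

type_synonym colouring = "(nat \<Rightarrow> nat) set \<Rightarrow> nat"

type_synonym template = "(nat \<Rightarrow> nat) set \<Rightarrow> nat set"

definition colourings :: "nat \<Rightarrow> nat \<Rightarrow> colouring set" where
  "colourings k n = cube_edges n \<rightarrow>\<^sub>E {1..k}"

definition zero_vert :: "nat \<Rightarrow> nat \<Rightarrow> nat" where
  "zero_vert n = (\<lambda>i\<in>{1..n}. 0)"

text \<open>
  The set \<open>B = {b\<^sub>1 < \<dots> < b\<^sub>m}\<close> of active coordinates is given by its increasing
  enumeration \<open>b\<close>; the condition \<open>m \<le> n\<close> is implied.
\<close>

definition order_embedding ::
    "nat \<Rightarrow> nat \<Rightarrow> ((nat \<Rightarrow> nat) \<Rightarrow> (nat \<Rightarrow> nat)) \<Rightarrow> bool" where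
  "order_embedding m n \<phi> \<longleftrightarrow>
     \<phi> \<in> cube_verts m \<rightarrow> cube_verts n \<and>
     (\<exists>b. strict_mono_on {1..m} b \<and> b ` {1..m} \<subseteq> {1..n} \<and>
        (\<forall>x \<in> cube_verts m.
           (\<forall>j \<in> {1..m}. \<phi> x (b j) = x j) \<and>
           (\<forall>i \<in> {1..n} - b ` {1..m}. \<phi> x i = \<phi> (zero_vert m) i)))"

definition pullback ::
    "nat \<Rightarrow> ((nat \<Rightarrow> nat) \<Rightarrow> (nat \<Rightarrow> nat)) \<Rightarrow> colouring \<Rightarrow> colouring" where
  "pullback m \<phi> c = (\<lambda>e \<in> cube_edges m. c (\<phi> ` e))"

definition order_hereditary :: "nat \<Rightarrow> (nat \<Rightarrow> colouring set) \<Rightarrow> bool" where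
  "order_hereditary k P \<longleftrightarrow>
     (\<forall>n. P n \<subseteq> colourings k n) \<and>
     (\<forall>m n c \<phi>. c \<in> P n \<and> order_embedding m n \<phi> \<longrightarrow> pullback m \<phi> c \<in> P m)"

definition templates :: "nat \<Rightarrow> nat \<Rightarrow> template set" where
  "templates k n = cube_edges n \<rightarrow>\<^sub>E {S. S \<subseteq> {1..k} \<and> S \<noteq> {}}"

definition realisations :: "nat \<Rightarrow> template \<Rightarrow> colouring set" where
  "realisations n t = (\<Pi>\<^sub>E e \<in> cube_edges n. t e)"

definition Ent :: "nat \<Rightarrow> nat \<Rightarrow> template \<Rightarrow> real" where
  "Ent k n t = (\<Sum>e \<in> cube_edges n. log (real k) (real (card (t e))))"

text \<open>
  The maximum is over a finite set, which is nonempty whenever \<open>P n\<close> is a nonempty set of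
  colourings (take a template with singleton values); otherwise the value is unspecified.
\<close>

definition ex_cube :: "nat \<Rightarrow> (nat \<Rightarrow> colouring set) \<Rightarrow> nat \<Rightarrow> real" where
  "ex_cube k P n = Max {Ent k n t | t. t \<in> templates k n \<and> realisations n t \<subseteq> P n}"

text \<open>
  The limit exists for every order-hereditary \<open>P\<close> with all \<open>P n\<close> nonempty. The term at
  \<open>n = 0\<close>, where the denominator vanishes, does not affect it.
\<close>

definition cube_density :: "nat \<Rightarrow> (nat \<Rightarrow> colouring set) \<Rightarrow> real" where
  "cube_density k P = lim (\<lambda>n. ex_cube k P n / (real n * 2 ^ (n - 1)))"

end

theory Submission
  imports Defs
begin

text \<open>
  Let \<open>c\<close> be uniform in \<open>P n\<close> and reveal the colours of \<open>c\<close> on a random set \<open>R\<close> of edges that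
  contains each edge with a small constant probability. For an edge \<open>e\<close> and a subcube \<open>Q\<close> of
  fixed dimension containing \<open>e\<close>, two random such \<open>Q\<close> share only \<open>e\<close> with high probability, so a second
  moment estimate shows that revealing \<open>Q - {e}\<close> in addition to \<open>R\<close> hardly changes the conditional
  law of \<open>c e\<close>, for most \<open>(e, Q)\<close>. Hence, conditionally on the revealed colours, the edges of most
  \<open>Q\<close> are nearly independent, and all choices of colours that are individually not too unlikely
  occur on \<open>Q\<close> simultaneously. The likely colours thus restrict to a template for \<open>P m\<close> on most
  subcubes, which bounds their total entropy by about the density of \<open>ex_cube k P m\<close>; the entropy
  of the likely colours in turn bounds \<open>log k (card (P n))\<close> by Gibbs' inequality. As
  \<open>ex_cube k P n \<le> log k (card (P n))\<close>, both normalised sequences converge to the infimum of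
  the densities, which also yields the existence of the limit.
\<close>

subsection \<open>Averages over random subsets\<close>

text \<open>The expectation of \<open>f R\<close> for a random \<open>R \<subseteq> E\<close>
  containing each element independently with probability \<open>p\<close>, written as a finite
  weighted sum.\<close>

definition bernoulli_avg :: "real \<Rightarrow> 'e set \<Rightarrow> ('e set \<Rightarrow> real) \<Rightarrow> real" where
  "bernoulli_avg p E f = (\<Sum>R\<in>Pow E. p ^ card R * (1 - p) ^ card (E - R) * f R)"

text \<open>Splitting by whether \<open>t \<in> R\<close> peels off one independent coin.
  \<open>bernoulli_avg_const\<close> and \<open>bernoulli_avg_member\<close> rest on this
  recursion.\<close>

lemma bernoulli_avg_insert:
  assumes "finite E" "t \<notin> E"
  shows "bernoulli_avg p (insert t E) f
       = p * bernoulli_avg p E (\<lambda>R. f (insert t R)) + (1 - p) * bernoulli_avg p E f"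
proof -
  have fin: "finite R" "t \<notin> R" "finite (E - R)" if "R \<in> Pow E" for R
    using that assms by (auto dest: finite_subset)
  have inj: "inj_on (insert t) (Pow E)"
    using assms by (auto simp: inj_on_def)
  have "bernoulli_avg p (insert t E) f
      = (\<Sum>R\<in>Pow E. p ^ card R * (1 - p) ^ card (insert t E - R) * f R)
      + (\<Sum>R\<in>insert t ` Pow E. p ^ card R * (1 - p) ^ card (insert t E - R) * f R)"
    unfolding bernoulli_avg_def Pow_insert
    by (rule sum.union_disjoint) (use assms in auto)
  also have "(\<Sum>R\<in>insert t ` Pow E. p ^ card R * (1 - p) ^ card (insert t E - R) * f R)
      = p * bernoulli_avg p E (\<lambda>R. f (insert t R))"
    unfolding bernoulli_avg_def sum_distrib_left sum.reindex[OF inj] o_def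
    by (rule sum.cong) (use assms fin in \<open>auto simp: mult.assoc\<close>)
  also have "(\<Sum>R\<in>Pow E. p ^ card R * (1 - p) ^ card (insert t E - R) * f R)
      = (1 - p) * bernoulli_avg p E f"
    unfolding bernoulli_avg_def sum_distrib_left
  proof (rule sum.cong)
    fix R assume R: "R \<in> Pow E"
    have "insert t E - R = insert t (E - R)" "t \<notin> E - R"
      using R assms by auto
    then show "p ^ card R * (1 - p) ^ card (insert t E - R) * f R
        = (1 - p) * (p ^ card R * (1 - p) ^ card (E - R) * f R)"
      using fin[OF R] by simp
  qed simp
  finally show ?thesis by simp
qed

lemma bernoulli_avg_mono:
  assumes "0 \<le> p" "p \<le> 1" "\<And>R. R \<subseteq> E \<Longrightarrow> f R \<le> g R"
  shows "bernoulli_avg p E f \<le> bernoulli_avg p E g"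
  unfolding bernoulli_avg_def
  by (rule sum_mono, rule mult_left_mono) (use assms in auto)

lemma bernoulli_avg_cong:
  assumes "\<And>R. R \<subseteq> E \<Longrightarrow> f R = g R"
  shows "bernoulli_avg p E f = bernoulli_avg p E g"
  unfolding bernoulli_avg_def by (rule sum.cong) (use assms in auto)

lemma bernoulli_avg_add:
  "bernoulli_avg p E (\<lambda>R. f R + g R) = bernoulli_avg p E f + bernoulli_avg p E g"
  unfolding bernoulli_avg_def by (simp add: ring_distribs sum.distrib)

lemma bernoulli_avg_diff:
  "bernoulli_avg p E (\<lambda>R. f R - g R) = bernoulli_avg p E f - bernoulli_avg p E g"
  unfolding bernoulli_avg_def by (simp add: ring_distribs sum_subtractf)

lemma bernoulli_avg_cmult: "bernoulli_avg p E (\<lambda>R. a * f R) = a * bernoulli_avg p E f"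
  unfolding bernoulli_avg_def by (simp add: sum_distrib_left mult_ac)

lemma bernoulli_avg_sum:
  "bernoulli_avg p E (\<lambda>R. \<Sum>j\<in>J. f j R) = (\<Sum>j\<in>J. bernoulli_avg p E (f j))"
  unfolding bernoulli_avg_def by (simp add: sum_distrib_left sum.swap[of _ J])

lemma bernoulli_avg_const:
  assumes "finite E" shows "bernoulli_avg p E (\<lambda>_. a) = a"
  using assms
proof (induction E rule: finite_induct)
  case empty
  then show ?case by (simp add: bernoulli_avg_def)
next
  case (insert t E)
  then show ?case by (simp add: bernoulli_avg_insert algebra_simps)
qed

text \<open>Only sets containing \<open>t\<close> contribute, with weight \<open>p\<close>; on the
  right the coin of \<open>t\<close> has no effect, since \<open>t\<close> is inserted
  anyway.\<close>

lemma bernoulli_avg_member: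
  assumes "finite E" "t \<in> E"
  shows "bernoulli_avg p E (\<lambda>R. of_bool (t \<in> R) * f R)
       = p * bernoulli_avg p E (\<lambda>R. f (insert t R))"
proof -
  obtain E' where E: "E = insert t E'" "t \<notin> E'"
    using assms by (meson mk_disjoint_insert)
  have "bernoulli_avg p E' (\<lambda>R. of_bool (t \<in> R) * f R) = bernoulli_avg p E' (\<lambda>R. 0)"
    by (rule bernoulli_avg_cong) (use E in auto)
  then show ?thesis
    using assms E by (simp add: bernoulli_avg_insert bernoulli_avg_const algebra_simps)
qed

text \<open>Conditioning on \<open>T \<subseteq> R\<close>, an event of probability
  \<open>p ^ card T\<close>, leaves the other elements independent, so the conditional law of
  \<open>R\<close> is that of \<open>R \<union> T\<close>.\<close>

lemma bernoulli_avg_superset: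
  assumes "finite E" "T \<subseteq> E"
  shows "bernoulli_avg p E (\<lambda>R. of_bool (T \<subseteq> R) * f R)
       = p ^ card T * bernoulli_avg p E (\<lambda>R. f (R \<union> T))"
proof -
  have "finite T" using assms finite_subset by blast
  then show ?thesis using assms(2)
  proof (induction T arbitrary: f rule: finite_induct)
    case empty
    then show ?case by simp
  next
    case (insert t T)
    have "bernoulli_avg p E (\<lambda>R. of_bool (insert t T \<subseteq> R) * f R)
        = bernoulli_avg p E (\<lambda>R. of_bool (t \<in> R) * (of_bool (T \<subseteq> R) * f R))"
      by (rule bernoulli_avg_cong) auto
    also have "\<dots> = p * bernoulli_avg p E (\<lambda>R. of_bool (T \<subseteq> insert t R) * f (insert t R))"
      using insert by (intro bernoulli_avg_member[OF assms(1)]) auto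
    also have "(\<lambda>R. of_bool (T \<subseteq> insert t R) * f (insert t R))
        = (\<lambda>R. of_bool (T \<subseteq> R) * f (insert t R))"
      using insert.hyps by (auto simp: fun_eq_iff subset_insert)
    also have "bernoulli_avg p E \<dots> = p ^ card T * bernoulli_avg p E (\<lambda>R. f (insert t (R \<union> T)))"
      by (rule insert.IH) (use insert.prems in auto)
    finally show ?case using insert.hyps by (simp add: mult_ac)
  qed
qed

lemma bernoulli_avg_card:
  assumes "finite E" shows "bernoulli_avg p E (\<lambda>R. real (card R)) = p * real (card E)"
proof -
  have "bernoulli_avg p E (\<lambda>R. real (card R))
      = bernoulli_avg p E (\<lambda>R. \<Sum>t\<in>E. of_bool (t \<in> R) * 1)"
  proof (rule bernoulli_avg_cong)
    fix R assume "R \<subseteq> E"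
    then have "E \<inter> R = R" by auto
    then show "real (card R) = (\<Sum>t\<in>E. of_bool (t \<in> R) * 1)"
      using assms by (simp add: of_bool_def sum.If_cases)
  qed
  also have "\<dots> = (\<Sum>t\<in>E. p * bernoulli_avg p E (\<lambda>R. 1))"
    unfolding bernoulli_avg_sum using assms by (intro sum.cong bernoulli_avg_member) auto
  finally show ?thesis using assms by (simp add: bernoulli_avg_const)
qed

text \<open>
  Adjoining \<open>T j\<close> amounts to conditioning on \<open>T j \<subseteq> R\<close>, so the average over \<open>j\<close> of the left-hand
  side is the mean of \<open>f (Y - 1)\<close> for the normalised number \<open>Y\<close> of the sets \<open>T j\<close> inside \<open>R\<close>,
  and \<open>Y\<close> has small variance. The term \<open>u\<close> comes from \<open>\<bar>y\<bar> \<le> u + y\<^sup>2 / u\<close>.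
\<close>

lemma bernoulli_avg_adjoin_le:
  fixes f :: "'e set \<Rightarrow> real"
  assumes E: "finite E" and J: "finite J" "J \<noteq> {}"
    and T: "\<And>j. j \<in> J \<Longrightarrow> T j \<subseteq> E" "\<And>j. j \<in> J \<Longrightarrow> card (T j) = s"
    and p: "0 < p" "p \<le> 1" and u: "0 < u"
    and overlap: "real (card {(i, j). i \<in> J \<and> j \<in> J \<and> T i \<inter> T j \<noteq> {}}) \<le> \<kappa> * real (card J) ^ 2"
    and f: "\<And>R. R \<subseteq> E \<Longrightarrow> 0 \<le> f R" "\<And>R. R \<subseteq> E \<Longrightarrow> f R \<le> 1"
  shows "(\<Sum>j\<in>J. bernoulli_avg p E (\<lambda>R. f (R \<union> T j)) - bernoulli_avg p E f)
       \<le> real (card J) * (u + \<kappa> / (p ^ s * u))"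
proof -
  define \<Delta> where "\<Delta> = real (card J)"
  have \<Delta>: "\<Delta> > 0" using J by (simp add: \<Delta>_def card_gt_0_iff)
  define Y where "Y R = (\<Sum>j\<in>J. of_bool (T j \<subseteq> R)) / (\<Delta> * p ^ s)" for R
  let ?B = "bernoulli_avg p E"
  have BT: "?B (\<lambda>R. of_bool (T j \<subseteq> R) * g R) = p ^ s * ?B (\<lambda>R. g (R \<union> T j))" if "j \<in> J" for j g
    using bernoulli_avg_superset[OF E T(1)[OF that], of p g] T(2)[OF that] by simp
  \<comment> \<open>Weighting by \<open>Y\<close> amounts to adjoining a random \<open>T j\<close>.
    This is applied to the constant \<open>1\<close> for the mean of \<open>Y\<close>, to
    \<open>Y\<close> itself for its second moment, and to the given \<open>f\<close>.\<close>
  have BY: "?B (\<lambda>R. f R * Y R) = (\<Sum>j\<in>J. ?B (\<lambda>R. f (R \<union> T j))) / \<Delta>" for f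
  proof -
    have "?B (\<lambda>R. f R * Y R) = ?B (\<lambda>R. 1 / (\<Delta> * p ^ s) * (\<Sum>j\<in>J. of_bool (T j \<subseteq> R) * f R))"
      by (simp add: Y_def sum_distrib_left sum_distrib_right sum_divide_distrib mult_ac)
    also have "\<dots> = 1 / (\<Delta> * p ^ s) * (\<Sum>j\<in>J. p ^ s * ?B (\<lambda>R. f (R \<union> T j)))"
      unfolding bernoulli_avg_cmult bernoulli_avg_sum using BT by simp
    also have "\<dots> = (\<Sum>j\<in>J. ?B (\<lambda>R. f (R \<union> T j))) / \<Delta>"
      using p by (simp add: sum_distrib_left[symmetric])
    finally show ?thesis .
  qed
  have EY: "?B Y = 1"
    using BY[of "\<lambda>_. 1"] \<Delta> E by (simp add: bernoulli_avg_const \<Delta>_def)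
  \<comment> \<open>A set disjoint from \<open>T j\<close> must lie in \<open>R\<close> itself,
    which gives the main term \<open>p ^ s\<close>; for the few overlapping pairs the trivial bound
    \<open>1\<close> suffices.\<close>
  have BTT: "?B (\<lambda>R. of_bool (T i \<subseteq> R \<union> T j)) \<le> p ^ s + of_bool (T i \<inter> T j \<noteq> {})"
    if ij: "i \<in> J" "j \<in> J" for i j
  proof (cases "T i \<inter> T j = {}")
    case True
    then have "(\<lambda>R. of_bool (T i \<subseteq> R \<union> T j)) = (\<lambda>R. of_bool (T i \<subseteq> R) * (1::real))"
      by (auto simp: fun_eq_iff)
    then show ?thesis using BT[OF ij(1), of "\<lambda>_. 1"] E True by (simp add: bernoulli_avg_const)
  next
    case False
    have "?B (\<lambda>R. of_bool (T i \<subseteq> R \<union> T j)) \<le> ?B (\<lambda>R. 1)"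
      by (rule bernoulli_avg_mono) (use p in auto)
    then show ?thesis using E False p by (simp add: bernoulli_avg_const add_increasing)
  qed
  have EY2: "?B (\<lambda>R. Y R * Y R) \<le> 1 + \<kappa> / p ^ s"
  proof -
    have "?B (\<lambda>R. Y R * Y R)
        = (\<Sum>j\<in>J. 1 / (\<Delta> * p ^ s) * (\<Sum>i\<in>J. ?B (\<lambda>R. of_bool (T i \<subseteq> R \<union> T j)))) / \<Delta>"
      unfolding BY unfolding bernoulli_avg_sum[symmetric] bernoulli_avg_cmult[symmetric]
      by (simp add: Y_def)
    also have "\<dots> \<le> (\<Sum>j\<in>J. 1 / (\<Delta> * p ^ s) * (\<Sum>i\<in>J. p ^ s + of_bool (T i \<inter> T j \<noteq> {}))) / \<Delta>"
      by (intro divide_right_mono sum_mono mult_left_mono BTT) (use \<Delta> p in auto)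
    also have "\<dots> = (\<Sum>j\<in>J. \<Sum>i\<in>J. p ^ s + of_bool (T i \<inter> T j \<noteq> {})) / (\<Delta>\<^sup>2 * p ^ s)"
      by (simp add: sum_divide_distrib power2_eq_square mult_ac)
    also have "(\<Sum>j\<in>J. \<Sum>i\<in>J. p ^ s + of_bool (T i \<inter> T j \<noteq> {}))
        = \<Delta>\<^sup>2 * p ^ s + (\<Sum>j\<in>J. \<Sum>i\<in>J. of_bool (T i \<inter> T j \<noteq> {}))"
      by (simp add: sum.distrib \<Delta>_def power2_eq_square)
    also have "(\<Sum>j\<in>J. \<Sum>i\<in>J. of_bool (T i \<inter> T j \<noteq> {}))
        = real (card {(i, j). i \<in> J \<and> j \<in> J \<and> T i \<inter> T j \<noteq> {}})"
    proof -
      have "(\<Sum>j\<in>J. \<Sum>i\<in>J. of_bool (T i \<inter> T j \<noteq> {})) =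
          (\<Sum>z\<in>J \<times> J. of_bool (T (fst z) \<inter> T (snd z) \<noteq> {}) :: real)"
        by (simp add: sum.cartesian_product case_prod_unfold Int_commute)
      also have "\<dots> = real (card ((J \<times> J) \<inter> {z. T (fst z) \<inter> T (snd z) \<noteq> {}}))"
        using J by (simp add: of_bool_def sum.If_cases)
      also have "(J \<times> J) \<inter> {z. T (fst z) \<inter> T (snd z) \<noteq> {}}
          = {(i, j). i \<in> J \<and> j \<in> J \<and> T i \<inter> T j \<noteq> {}}"
        by auto
      finally show ?thesis .
    qed
    also have "(\<Delta>\<^sup>2 * p ^ s + \<dots>) / (\<Delta>\<^sup>2 * p ^ s) \<le> (\<Delta>\<^sup>2 * p ^ s + \<kappa> * \<Delta>\<^sup>2) / (\<Delta>\<^sup>2 * p ^ s)"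
      using overlap \<Delta> p by (intro divide_right_mono) (auto simp: \<Delta>_def)
    also have "\<dots> = 1 + \<kappa> / p ^ s"
      using \<Delta> p by (simp add: field_simps)
    finally show ?thesis .
  qed
  have "?B (\<lambda>R. f R * Y R - f R) \<le> ?B (\<lambda>R. u + 1 / u * (Y R * Y R - 2 * Y R + 1))"
  proof (rule bernoulli_avg_mono)
    fix R assume R: "R \<subseteq> E"
    have "f R * Y R - f R = f R * (Y R - 1)" by (simp add: algebra_simps)
    also have "\<dots> \<le> f R * \<bar>Y R - 1\<bar>"
      using f[OF R] by (intro mult_left_mono) auto
    also have "\<dots> \<le> 1 * \<bar>Y R - 1\<bar>"
      using f[OF R] by (intro mult_right_mono) auto
    also have "1 * \<bar>Y R - 1\<bar> \<le> u + 1 / u * (\<bar>Y R - 1\<bar>)\<^sup>2"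
    proof -
      have "u * \<bar>Y R - 1\<bar> \<le> u\<^sup>2 + (\<bar>Y R - 1\<bar>)\<^sup>2"
      proof -
        have "0 \<le> u * \<bar>Y R - 1\<bar>" using u by simp
        moreover have "2 * (u * \<bar>Y R - 1\<bar>) \<le> u\<^sup>2 + (\<bar>Y R - 1\<bar>)\<^sup>2"
          using sum_squares_bound[of u "\<bar>Y R - 1\<bar>"] by (simp only: mult.assoc)
        ultimately show ?thesis by linarith
      qed
      then show ?thesis using u by (simp add: field_simps power2_eq_square)
    qed
    also have "\<dots> = u + 1 / u * (Y R * Y R - 2 * Y R + 1)"
      by (simp add: power2_eq_square algebra_simps)
    finally show "f R * Y R - f R \<le> u + 1 / u * (Y R * Y R - 2 * Y R + 1)" .
  qed (use p in auto)
  also have "\<dots> = u + 1 / u * (?B (\<lambda>R. Y R * Y R) - 1)"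
    unfolding bernoulli_avg_add bernoulli_avg_cmult bernoulli_avg_diff bernoulli_avg_const[OF E] EY
    by simp
  also have "\<dots> \<le> u + 1 / u * (\<kappa> / p ^ s)"
    using EY2 u by (intro add_left_mono mult_left_mono) auto
  finally have "(\<Sum>j\<in>J. ?B (\<lambda>R. f (R \<union> T j))) / \<Delta> - ?B f \<le> u + \<kappa> / (p ^ s * u)"
    unfolding bernoulli_avg_diff BY by (simp add: mult.commute)
  then have "(\<Sum>j\<in>J. ?B (\<lambda>R. f (R \<union> T j))) - \<Delta> * ?B f \<le> \<Delta> * (u + \<kappa> / (p ^ s * u))"
    using \<Delta> by (simp add: field_simps)
  then show ?thesis by (simp add: sum_subtractf \<Delta>_def)
qed

subsection \<open>Conditional laws in a family of colourings\<close>

text \<open>The probabilistic argument is carried out for a nonempty set of colourings of any finite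
  set; the hypercube enters later by interpretation.\<close>

locale colouring_family =
  fixes k :: nat and E :: "'e set" and C :: "('e \<Rightarrow> nat) set"
  assumes k_ge_2: "2 \<le> k" and finite_E: "finite E"
    and C_sub: "C \<subseteq> E \<rightarrow>\<^sub>E {1..k}" and C_nonempty: "C \<noteq> {}"
begin

lemma finite_C: "finite C"
  using C_sub finite_E by (meson finite_PiE finite_atLeastAtMost finite_subset)

lemma card_C_pos: "0 < real (card C)"
  using finite_C C_nonempty by (simp add: card_gt_0_iff)

lemma C_colour: "c \<in> C \<Longrightarrow> e \<in> E \<Longrightarrow> c e \<in> {1..k}"
  using C_sub by blast

text \<open>The cell of \<open>c\<close> in the partition of \<open>C\<close> by the colours on
  \<open>A\<close>.\<close>

definition agree :: "'e set \<Rightarrow> ('e \<Rightarrow> nat) \<Rightarrow> ('e \<Rightarrow> nat) set" where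
  "agree A c = {c' \<in> C. \<forall>e\<in>A. c' e = c e}"

text \<open>Conditional expectation given the colours on \<open>A\<close>, for the uniform law on
  \<open>C\<close>.\<close>

definition cond_mean :: "'e set \<Rightarrow> (('e \<Rightarrow> nat) \<Rightarrow> real) \<Rightarrow> ('e \<Rightarrow> nat) \<Rightarrow> real" where
  "cond_mean A g c = (\<Sum>c'\<in>agree A c. g c') / real (card (agree A c))"

definition cond_prob :: "'e set \<Rightarrow> 'e \<Rightarrow> nat \<Rightarrow> ('e \<Rightarrow> nat) \<Rightarrow> real" where
  "cond_prob A e a = cond_mean A (\<lambda>c. of_bool (c e = a))"

text \<open>The candidate template once the colours on \<open>A\<close> are revealed.\<close>

definition likely_colours :: "real \<Rightarrow> 'e set \<Rightarrow> ('e \<Rightarrow> nat) \<Rightarrow> 'e \<Rightarrow> nat set" where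
  "likely_colours \<delta> A c e = {a \<in> {1..k}. \<delta> \<le> cond_prob A e a c}"

text \<open>The mean square of the conditional law of the colour of \<open>e\<close>, as in energy
  increment arguments: a bounded quantity that can only grow with \<open>A\<close>.\<close>

definition energy :: "'e \<Rightarrow> 'e set \<Rightarrow> real" where
  "energy e A = (\<Sum>c\<in>C. \<Sum>a\<in>{1..k}. (cond_prob A e a c)\<^sup>2) / real (card C)"

text \<open>The expected squared change in the conditional law of each \<open>e \<in> Q\<close> when
  the rest of \<open>Q\<close> is revealed as well. It is conditioned on the colours on
  \<open>A\<close>, so it is constant on each cell of \<open>A\<close>.\<close>

definition discrepancy :: "'e set \<Rightarrow> 'e set \<Rightarrow> ('e \<Rightarrow> nat) \<Rightarrow> real" where
  "discrepancy A Q c =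
     (\<Sum>e\<in>Q. \<Sum>a\<in>{1..k}.
        cond_mean A (\<lambda>c'. (cond_prob (A \<union> (Q - {e})) e a c' - cond_prob A e a c')\<^sup>2) c)"

lemma finite_agree: "finite (agree A c)"
  using finite_C by (simp add: agree_def)

lemma agree_self: "c \<in> C \<Longrightarrow> c \<in> agree A c"
  by (simp add: agree_def)

lemma agree_subset: "agree A c \<subseteq> C"
  by (auto simp: agree_def)

lemma agree_eq: "c' \<in> agree A c \<Longrightarrow> agree A c' = agree A c"
  by (auto simp: agree_def)

lemma agree_mono: "A \<subseteq> B \<Longrightarrow> c' \<in> agree B c \<Longrightarrow> c' \<in> agree A c"
  by (auto simp: agree_def)

lemma card_agree_pos: "c \<in> C \<Longrightarrow> 0 < real (card (agree A c))"
  using agree_self[of c A] finite_agree[of A c] by (auto simp: card_gt_0_iff)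

lemma cond_mean_agree: "c' \<in> agree A c \<Longrightarrow> cond_mean A g c' = cond_mean A g c"
  by (simp add: cond_mean_def agree_eq)

lemma cond_prob_agree: "c' \<in> agree A c \<Longrightarrow> cond_prob A e a c' = cond_prob A e a c"
  by (simp add: cond_prob_def cond_mean_agree)

section \<open>Conditional expectation as an orthogonal projection\<close>

lemma cond_mean_const:
  assumes "c \<in> C" "\<And>c'. c' \<in> agree A c \<Longrightarrow> g c' = b"
  shows "cond_mean A g c = b"
  using card_agree_pos[OF assms(1), of A] assms(2) by (simp add: cond_mean_def)

lemma cond_mean_sum: "cond_mean A (\<lambda>c. \<Sum>j\<in>J. g j c) c = (\<Sum>j\<in>J. cond_mean A (g j) c)"
  by (simp add: cond_mean_def sum.swap[of _ J] sum_divide_distrib)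

lemma cond_mean_diff:
  "cond_mean A (\<lambda>c. g c - h c) c = cond_mean A g c - cond_mean A h c"
  by (simp add: cond_mean_def sum_subtractf diff_divide_distrib)

lemma cond_mean_cmult: "cond_mean A (\<lambda>c. b * g c) c = b * cond_mean A g c"
  by (simp add: cond_mean_def sum_distrib_left)

lemma cond_mean_mono:
  assumes "\<And>c'. c' \<in> agree A c \<Longrightarrow> g c' \<le> h c'"
  shows "cond_mean A g c \<le> cond_mean A h c"
  unfolding cond_mean_def by (intro divide_right_mono sum_mono assms) auto

text \<open>Conditional expectation is self-adjoint: both sides are sums over pairs in a common
  cell, weighted by the inverse of the size of that cell.\<close>

lemma sum_cond_mean_mult:
  "(\<Sum>c\<in>C. cond_mean A g c * h c) = (\<Sum>c\<in>C. g c * cond_mean A h c)"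
proof -
  have sym: "c' \<in> agree A c \<longleftrightarrow> c \<in> agree A c'" if "c \<in> C" "c' \<in> C" for c c'
    using that by (auto simp: agree_def)
  have *: "cond_mean A g c = (\<Sum>c'\<in>C. of_bool (c' \<in> agree A c) * g c' / real (card (agree A c)))"
    for g c
  proof -
    have "C \<inter> agree A c = agree A c" using agree_subset by auto
    then show ?thesis
      using finite_C by (simp add: cond_mean_def sum_divide_distrib[symmetric] of_bool_def
          if_distrib[of "\<lambda>x. x * _"] sum.If_cases Collect_mem_eq cong: if_cong)
  qed
  have "(\<Sum>c\<in>C. cond_mean A g c * h c)
      = (\<Sum>c\<in>C. \<Sum>c'\<in>C. of_bool (c' \<in> agree A c) * g c' * h c / real (card (agree A c)))"
    by (simp add: * sum_distrib_right)
  also have "\<dots> = (\<Sum>c'\<in>C. \<Sum>c\<in>C. of_bool (c' \<in> agree A c) * g c' * h c / real (card (agree A c)))"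
    by (rule sum.swap)
  also have "\<dots> = (\<Sum>c'\<in>C. \<Sum>c\<in>C. g c' * (of_bool (c \<in> agree A c') * h c / real (card (agree A c'))))"
    by (intro sum.cong refl) (use sym agree_eq in \<open>auto simp: of_bool_def\<close>)
  also have "\<dots> = (\<Sum>c\<in>C. g c * cond_mean A h c)"
    by (simp only: * sum_distrib_left)
  finally show ?thesis .
qed

lemma sum_cond_mean: "(\<Sum>c\<in>C. cond_mean A g c) = (\<Sum>c\<in>C. g c)"
proof -
  have "(\<Sum>c\<in>C. g c * cond_mean A (\<lambda>_. 1) c) = (\<Sum>c\<in>C. g c * 1)"
    by (intro sum.cong refl) (simp add: cond_mean_const)
  then show ?thesis using sum_cond_mean_mult[of A g "\<lambda>_. 1"] by simp
qed

text \<open>A function determined by the colours on \<open>A\<close> is its own conditional mean, so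
  self-adjointness lets it be pulled out.\<close>

lemma sum_mult_cond_mean:
  assumes "\<And>c c'. c \<in> C \<Longrightarrow> c' \<in> agree A c \<Longrightarrow> h c' = h c"
  shows "(\<Sum>c\<in>C. h c * cond_mean A g c) = (\<Sum>c\<in>C. h c * g c)"
proof -
  have "(\<Sum>c\<in>C. cond_mean A h c * g c) = (\<Sum>c\<in>C. h c * g c)"
    by (intro sum.cong refl arg_cong2[where f = "(*)"] cond_mean_const) (use assms in auto)
  then show ?thesis using sum_cond_mean_mult[of A h g] by simp
qed

text \<open>Pythagoras for nested projections: the coarser conditional mean is orthogonal to the
  difference of the two.\<close>

lemma sum_cond_mean_diff_square:
  assumes "A \<subseteq> B"
  shows "(\<Sum>c\<in>C. (cond_mean B g c - cond_mean A g c)\<^sup>2)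
       = (\<Sum>c\<in>C. (cond_mean B g c)\<^sup>2) - (\<Sum>c\<in>C. (cond_mean A g c)\<^sup>2)"
proof -
  have "(\<Sum>c\<in>C. cond_mean A g c * cond_mean B g c) = (\<Sum>c\<in>C. cond_mean A g c * g c)"
    by (rule sum_mult_cond_mean) (meson assms agree_mono cond_mean_agree)
  moreover have "(\<Sum>c\<in>C. cond_mean A g c * cond_mean A g c) = (\<Sum>c\<in>C. cond_mean A g c * g c)"
    by (rule sum_mult_cond_mean) (rule cond_mean_agree)
  ultimately have "(\<Sum>c\<in>C. cond_mean A g c * cond_mean B g c)
      = (\<Sum>c\<in>C. cond_mean A g c * cond_mean A g c)"
    by simp
  moreover have "(\<Sum>c\<in>C. (cond_mean B g c - cond_mean A g c)\<^sup>2)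
      = (\<Sum>c\<in>C. (cond_mean B g c)\<^sup>2) + (\<Sum>c\<in>C. cond_mean A g c * cond_mean A g c)
        - 2 * (\<Sum>c\<in>C. cond_mean A g c * cond_mean B g c)"
    unfolding sum_distrib_left sum.distrib[symmetric] sum_subtractf[symmetric]
    by (intro sum.cong refl) (simp add: power2_eq_square algebra_simps)
  ultimately show ?thesis by (simp add: power2_eq_square)
qed

lemma cond_prob_nonneg: "0 \<le> cond_prob A e a c"
  unfolding cond_prob_def cond_mean_def by (intro divide_nonneg_nonneg sum_nonneg) auto

lemma sum_cond_prob:
  assumes "c \<in> C" "e \<in> E" shows "(\<Sum>a\<in>{1..k}. cond_prob A e a c) = 1"
proof -
  have "(\<Sum>a\<in>{1..k}. cond_prob A e a c) = cond_mean A (\<lambda>c. \<Sum>a\<in>{1..k}. of_bool (c e = a)) c"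
    by (simp only: cond_prob_def cond_mean_sum)
  also have "\<dots> = 1"
  proof (rule cond_mean_const[OF assms(1)])
    fix c' assume "c' \<in> agree A c"
    then have "c' e \<in> {1..k}" using C_colour[OF _ assms(2)] agree_subset by blast
    then show "(\<Sum>a\<in>{1..k}. of_bool (c' e = a)) = (1 :: real)"
      by (simp add: of_bool_def sum.delta)
  qed
  finally show ?thesis .
qed

section \<open>Energy and discrepancy\<close>

lemma energy_nonneg: "0 \<le> energy e A"
  unfolding energy_def by (intro divide_nonneg_nonneg sum_nonneg) auto

lemma energy_le_1:
  assumes "e \<in> E" shows "energy e A \<le> 1"
proof -
  have "(\<Sum>a\<in>{1..k}. (cond_prob A e a c)\<^sup>2) \<le> 1" if c: "c \<in> C" for c
  proof -
    have "cond_prob A e a c \<le> 1" if "a \<in> {1..k}" for a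
      using member_le_sum[OF that, of "\<lambda>a. cond_prob A e a c"] cond_prob_nonneg
        sum_cond_prob[OF c assms] by simp
    then have "(\<Sum>a\<in>{1..k}. (cond_prob A e a c)\<^sup>2) \<le> (\<Sum>a\<in>{1..k}. cond_prob A e a c)"
      by (intro sum_mono) (simp add: power2_eq_square mult_left_le cond_prob_nonneg)
    then show ?thesis using sum_cond_prob[OF c assms] by simp
  qed
  then have "(\<Sum>c\<in>C. \<Sum>a\<in>{1..k}. (cond_prob A e a c)\<^sup>2) \<le> (\<Sum>c\<in>C. 1)"
    by (intro sum_mono) auto
  then show ?thesis using card_C_pos by (simp add: energy_def)
qed

text \<open>Summing over \<open>C\<close> removes the outer conditional mean, and by Pythagoras the
  remaining squared differences are energy increments.\<close>

lemma sum_discrepancy: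
  "(\<Sum>c\<in>C. discrepancy A Q c)
     = real (card C) * (\<Sum>e\<in>Q. energy e (A \<union> (Q - {e})) - energy e A)"
proof -
  have "(\<Sum>c\<in>C. discrepancy A Q c)
      = (\<Sum>e\<in>Q. \<Sum>a\<in>{1..k}. \<Sum>c\<in>C.
          (cond_prob (A \<union> (Q - {e})) e a c - cond_prob A e a c)\<^sup>2)"
    unfolding discrepancy_def sum.swap[of _ _ C] sum_cond_mean ..
  also have "\<dots> = (\<Sum>e\<in>Q. \<Sum>a\<in>{1..k}.
       (\<Sum>c\<in>C. (cond_prob (A \<union> (Q - {e})) e a c)\<^sup>2) - (\<Sum>c\<in>C. (cond_prob A e a c)\<^sup>2))"
    unfolding cond_prob_def by (subst sum_cond_mean_diff_square) auto
  also have "\<dots> = (\<Sum>e\<in>Q. real (card C) * (energy e (A \<union> (Q - {e})) - energy e A))"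
    using card_C_pos
    by (intro sum.cong refl) (simp add: energy_def right_diff_distrib sum_subtractf sum.swap[of _ C])
  finally show ?thesis by (simp add: sum_distrib_left)
qed

lemma discrepancy_nonneg: "0 \<le> discrepancy A Q c"
  unfolding discrepancy_def cond_mean_def by (intro sum_nonneg divide_nonneg_nonneg) auto

text \<open>
  Conditionally on \<open>agree A c\<close>, the colours prescribed by \<open>x\<close> are imposed one edge at a time;
  each step multiplies the probability by at least \<open>\<delta>\<close> up to an additive error \<open>\<mu>\<close>, because the
  edges imposed before lie in \<open>Q - {e}\<close>.
\<close>

lemma realised_if_discrepancy_small:
  assumes Q: "finite Q" and c: "c \<in> C" and \<delta>: "0 < \<delta>" "\<delta> \<le> 1"
    and small: "discrepancy A Q c \<le> (\<delta> / 2) ^ (2 * card Q)"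
    and x: "\<And>e. e \<in> Q \<Longrightarrow> x e \<in> likely_colours \<delta> A c e"
  shows "\<exists>c'\<in>agree A c. \<forall>e\<in>Q. c' e = x e"
proof -
  \<comment> \<open>The square of \<open>\<mu>\<close> is the threshold assumed for the
    discrepancy.\<close>
  define \<mu> where "\<mu> = (\<delta> / 2) ^ card Q"
  have \<mu>: "\<mu> > 0" using \<delta> by (simp add: \<mu>_def)
  have small': "discrepancy A Q c \<le> \<mu>\<^sup>2"
    using small by (simp add: \<mu>_def power_mult[symmetric] mult.commute)
  define I where "I S c' = (of_bool (\<forall>e\<in>S. c' e = x e) :: real)" for S c'
  have step: "cond_mean A (I (insert e S)) c \<ge> \<delta> * cond_mean A (I S) c - \<mu>"
    if e: "e \<in> Q" and S: "S \<subseteq> Q - {e}" for e S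
  proof -
    define B where "B = A \<union> (Q - {e})"
    define d where "d c' = cond_prob B e (x e) c' - cond_prob A e (x e) c'" for c'
    \<comment> \<open>As \<open>S \<subseteq> Q - {e}\<close>, this indicator is determined by the
      colours on \<open>B\<close>. Hence the event \<open>c' e = x e\<close> may be replaced by its
      conditional probability given \<open>B\<close>.\<close>
    define h where "h c' = of_bool (c' \<in> agree A c) * I S c'" for c'
    have restr: "(\<Sum>c'\<in>agree A c. I S c' * g c') = (\<Sum>c'\<in>C. h c' * g c')" for g
      by (rule sum.mono_neutral_cong_left) (use finite_C agree_subset in \<open>auto simp: h_def\<close>)
    have "(\<Sum>c'\<in>agree A c. I (insert e S) c') = (\<Sum>c'\<in>agree A c. I S c' * of_bool (c' e = x e))"
      by (rule sum.cong) (auto simp: I_def)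
    also have "\<dots> = (\<Sum>c'\<in>C. h c' * of_bool (c' e = x e))" by (rule restr)
    also have "\<dots> = (\<Sum>c'\<in>C. h c' * cond_prob B e (x e) c')"
      unfolding cond_prob_def
    proof (rule sum_mult_cond_mean[symmetric])
      fix c1 c2 assume "c1 \<in> C" "c2 \<in> agree B c1"
      then show "h c2 = h c1"
        using S by (fastforce simp: h_def I_def agree_def B_def)
    qed
    also have "\<dots> = (\<Sum>c'\<in>agree A c. I S c' * cond_prob B e (x e) c')" by (rule restr[symmetric])
    finally have eq: "cond_mean A (I (insert e S)) c
        = cond_mean A (\<lambda>c'. I S c' * cond_prob B e (x e) c') c"
      by (simp add: cond_mean_def)
    have x_e: "x e \<in> {1..k}" "\<delta> \<le> cond_prob A e (x e) c"
      using x[OF e] by (auto simp: likely_colours_def)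
    have "cond_mean A (\<lambda>c'. (d c')\<^sup>2) c \<le> discrepancy A Q c"
    proof -
      have "cond_mean A (\<lambda>c'. (d c')\<^sup>2) c \<le> (\<Sum>a\<in>{1..k}.
          cond_mean A (\<lambda>c'. (cond_prob B e a c' - cond_prob A e a c')\<^sup>2) c)"
        unfolding d_def using x_e
        by (intro member_le_sum[where f = "\<lambda>a. cond_mean A (\<lambda>c'. (cond_prob B e a c' - cond_prob A e a c')\<^sup>2) c"])
          (auto simp: cond_mean_def intro!: sum_nonneg divide_nonneg_nonneg)
      also have "\<dots> \<le> discrepancy A Q c"
        unfolding discrepancy_def B_def using e Q
        by (intro member_le_sum[where f = "\<lambda>e. \<Sum>a\<in>{1..k}. cond_mean A (\<lambda>c'. (cond_prob (A \<union> (Q - {e})) e a c' - cond_prob A e a c')\<^sup>2) c"])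
          (auto simp: cond_mean_def intro!: sum_nonneg divide_nonneg_nonneg)
      finally show ?thesis .
    qed
    then have d2: "cond_mean A (\<lambda>c'. (d c')\<^sup>2) c \<le> \<mu>\<^sup>2" using small' by simp
    \<comment> \<open>By \<open>2 * \<mu> * \<bar>d\<bar> \<le> \<mu>\<^sup>2 + d\<^sup>2\<close>, a
      second moment of at most \<open>\<mu>\<^sup>2\<close> bounds the mean of
      \<open>\<bar>d\<bar>\<close> by \<open>\<mu>\<close>, the additive loss of one step.\<close>
    have "\<delta> * cond_mean A (I S) c - \<mu> \<le> \<delta> * cond_mean A (I S) c - (\<mu> + 1 / \<mu> * cond_mean A (\<lambda>c'. (d c')\<^sup>2) c) / 2"
      using d2 \<mu> by (simp add: field_simps power2_eq_square)
    also have "\<dots> = cond_mean A (\<lambda>c'. \<delta> * I S c' - (\<mu> + 1 / \<mu> * (d c')\<^sup>2) / 2) c"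
    proof -
      have "cond_mean A (\<lambda>c'. \<delta> * I S c' - (\<mu> + 1 / \<mu> * (d c')\<^sup>2) / 2) c
          = cond_mean A (\<lambda>c'. (\<delta> * I S c' - \<mu> / 2) - 1 / (2 * \<mu>) * (d c')\<^sup>2) c"
        by (simp add: add_divide_distrib algebra_simps)
      moreover have "cond_mean A (\<lambda>_. \<mu> / 2) c = \<mu> / 2"
        by (rule cond_mean_const[OF c]) simp
      ultimately show ?thesis
        unfolding cond_mean_diff cond_mean_cmult
        by (simp add: add_divide_distrib algebra_simps)
    qed
    also have "\<dots> \<le> cond_mean A (\<lambda>c'. I S c' * cond_prob B e (x e) c') c"
    proof (rule cond_mean_mono)
      fix c' assume c': "c' \<in> agree A c"
      have aux: "\<delta> * i - w \<le> i * v" if "\<bar>y\<bar> \<le> w" "\<delta> - \<bar>y\<bar> \<le> v" "i = 0 \<or> i = 1" for i v w y :: real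
        using that by auto
      have "2 * (\<mu> * \<bar>d c'\<bar>) \<le> \<mu>\<^sup>2 + (d c')\<^sup>2"
        using sum_squares_bound[of \<mu> "\<bar>d c'\<bar>"] by simp
      then have "\<bar>d c'\<bar> \<le> (\<mu> + 1 / \<mu> * (d c')\<^sup>2) / 2"
        using \<mu> by (simp add: field_simps power2_eq_square)
      moreover have "cond_prob B e (x e) c' \<ge> \<delta> - \<bar>d c'\<bar>"
        using x_e cond_prob_agree[OF c', of e "x e"] by (simp add: d_def)
      moreover have "I S c' = 0 \<or> I S c' = 1" by (auto simp: I_def)
      ultimately show "\<delta> * I S c' - (\<mu> + 1 / \<mu> * (d c')\<^sup>2) / 2 \<le> I S c' * cond_prob B e (x e) c'"
        by (rule aux)
    qed
    finally show ?thesis using eq by simp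
  qed
  \<comment> \<open>A step turns the lower bound \<open>b = (\<delta> / 2) ^ card S\<close> into
    \<open>\<delta> * b - \<mu>\<close>, and \<open>\<mu> \<le> \<delta> * b / 2\<close> as long as
    \<open>card S < card Q\<close>; hence the rate \<open>\<delta> / 2\<close>.\<close>
  have "S \<subseteq> Q \<Longrightarrow> cond_mean A (I S) c \<ge> (\<delta> / 2) ^ card S" if "finite S" for S
    using that
  proof (induction S rule: finite_induct)
    case empty
    have "cond_mean A (I {}) c = 1" by (rule cond_mean_const[OF c]) (simp add: I_def)
    then show ?case by simp
  next
    case (insert e S)
    have "card (insert e S) \<le> card Q" using insert.prems Q by (intro card_mono) auto
    then have "\<mu> \<le> (\<delta> / 2) ^ card (insert e S)"
      unfolding \<mu>_def using \<delta> by (intro power_decreasing) auto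
    moreover have "(\<delta> / 2) ^ card S \<le> cond_mean A (I S) c"
      using insert by simp
    then have "\<delta> * (\<delta> / 2) ^ card S \<le> \<delta> * cond_mean A (I S) c"
      using \<delta> by simp
    moreover have "cond_mean A (I (insert e S)) c \<ge> \<delta> * cond_mean A (I S) c - \<mu>"
      by (rule step) (use insert in auto)
    ultimately show ?case using insert.hyps by simp
  qed
  from this[OF Q] have "cond_mean A (I Q) c > 0"
    using \<delta> by (smt (verit) zero_less_power half_gt_zero order_refl)
  then have "\<exists>c'\<in>agree A c. I Q c' \<noteq> 0"
    by (metis (mono_tags, lifting) cond_mean_def div_0 less_irrefl sum.neutral)
  then show ?thesis by (auto simp: I_def)
qed

end

subsection \<open>Entropy bounds\<close>

text \<open>Gibbs' inequality for the uniform law on \<open>C\<close> against a subprobability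
  \<open>q\<close>, from \<open>ln y \<le> y - 1\<close> at \<open>y = M * q c\<close>.\<close>

lemma log_card_le_average:
  fixes q :: "'c \<Rightarrow> real"
  assumes "finite C" "C \<noteq> {}" "1 < b" "\<And>c. c \<in> C \<Longrightarrow> 0 < q c" "(\<Sum>c\<in>C. q c) \<le> 1"
  shows "log b (real (card C)) \<le> (\<Sum>c\<in>C. log b (1 / q c)) / real (card C)"
proof -
  define M where "M = real (card C)"
  have M: "M > 0" using assms by (simp add: M_def card_gt_0_iff)
  have "(\<Sum>c\<in>C. ln M - ln (1 / q c)) \<le> (\<Sum>c\<in>C. M * q c - 1)"
  proof (rule sum_mono)
    fix c assume "c \<in> C"
    then have "0 < q c" by (rule assms)
    then have "ln M - ln (1 / q c) = ln (M * q c)" using M by (simp add: ln_mult ln_div)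
    also have "\<dots> \<le> M * q c - 1" using \<open>0 < q c\<close> M by (intro ln_le_minus_one) simp
    finally show "ln M - ln (1 / q c) \<le> M * q c - 1" .
  qed
  also have "\<dots> = M * (\<Sum>c\<in>C. q c) - M" by (simp add: sum_subtractf sum_distrib_left M_def)
  also have "\<dots> \<le> 0" using assms M by (simp add: mult_le_cancel_left1)
  finally have "M * ln M \<le> (\<Sum>c\<in>C. ln (1 / q c))" by (simp add: sum_subtractf M_def)
  then have "ln M \<le> (\<Sum>c\<in>C. ln (1 / q c)) / M" using M by (simp add: field_simps)
  then have "ln M / ln b \<le> (\<Sum>c\<in>C. ln (1 / q c)) / M / ln b"
    using assms by (intro divide_right_mono) auto
  then show ?thesis by (simp add: log_def M_def sum_divide_distrib divide_divide_eq_left mult.commute)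
qed

lemma sum_incidence:
  assumes "finite I" "finite E" "\<And>i. i \<in> I \<Longrightarrow> Q i \<subseteq> E"
  shows "(\<Sum>i\<in>I. \<Sum>e\<in>Q i. g i e) = (\<Sum>e\<in>E. \<Sum>i | i \<in> I \<and> e \<in> Q i. g i e)"
proof -
  have "(\<Sum>i\<in>I. \<Sum>e\<in>Q i. g i e) = (\<Sum>i\<in>I. \<Sum>e | e \<in> E \<and> e \<in> Q i. g i e)"
    using assms(3) by (intro sum.cong refl) auto
  also have "\<dots> = (\<Sum>e\<in>E. \<Sum>i | i \<in> I \<and> e \<in> Q i. g i e)"
    by (rule sum.swap_restrict) (use assms in auto)
  finally show ?thesis .
qed

context colouring_family
begin

lemma likely_colours_agree: "c' \<in> agree A c \<Longrightarrow> likely_colours \<delta> A c' e = likely_colours \<delta> A c e"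
  by (simp add: likely_colours_def cond_prob_agree)

lemma finite_likely_colours: "finite (likely_colours \<delta> A c e)"
  by (simp add: likely_colours_def)

lemma likely_colours_nonempty:
  assumes "c \<in> C" "e \<in> E" "real k * \<delta> \<le> 1"
  shows "likely_colours \<delta> A c e \<noteq> {}"
proof
  assume "likely_colours \<delta> A c e = {}"
  then have "\<And>a. a \<in> {1..k} \<Longrightarrow> cond_prob A e a c < \<delta>" by (auto simp: likely_colours_def)
  then have "(\<Sum>a\<in>{1..k}. cond_prob A e a c) < (\<Sum>a\<in>{1..k}. \<delta>)"
    using k_ge_2 by (intro sum_strict_mono) auto
  then show False using sum_cond_prob[OF assms(1,2)] assms(3) by simp
qed

text \<open>Which colours are unlikely is determined by the colours on \<open>A\<close>; given
  those, each of the at most \<open>k\<close> unlikely colours occurs with probability below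
  \<open>\<delta>\<close>.\<close>

lemma sum_unlikely_le:
  fixes \<delta> :: real
  assumes "e \<in> E" "0 \<le> \<delta>"
  shows "(\<Sum>c\<in>C. of_bool (c e \<notin> likely_colours \<delta> A c e)) \<le> real (card C) * (real k * \<delta>)"
proof -
  define h where "h a c = (of_bool (a \<notin> likely_colours \<delta> A c e) :: real)" for a c
  have "(\<Sum>c\<in>C. of_bool (c e \<notin> likely_colours \<delta> A c e))
      = (\<Sum>c\<in>C. \<Sum>a\<in>{1..k}. h a c * of_bool (c e = a))"
  proof (rule sum.cong[OF refl])
    fix c assume "c \<in> C"
    then have "c e \<in> {1..k}" using C_colour assms by blast
    then show "of_bool (c e \<notin> likely_colours \<delta> A c e) = (\<Sum>a\<in>{1..k}. h a c * of_bool (c e = a))"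
      by (simp add: h_def of_bool_def if_distrib[of "\<lambda>x. _ * x"] sum.delta cong: if_cong)
  qed
  also have "\<dots> = (\<Sum>a\<in>{1..k}. \<Sum>c\<in>C. h a c * cond_prob A e a c)"
    unfolding sum.swap[of _ _ C] cond_prob_def
    by (intro sum.cong refl sum_mult_cond_mean[symmetric]) (simp add: h_def likely_colours_agree)
  also have "\<dots> \<le> (\<Sum>a\<in>{1..k}. \<Sum>c\<in>C. \<delta>)"
    by (intro sum_mono) (use assms in \<open>auto simp: h_def likely_colours_def\<close>)
  finally show ?thesis by (simp add: mult_ac)
qed

text \<open>The terms are the cost of revealing \<open>c\<close> on \<open>A\<close>, the overhead
  of the mixing weight \<open>\<gamma>\<close> and of the unlikely colours, and the mean entropy of
  the likely colours.\<close>

lemma log_card_le_likely_colours: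
  fixes \<gamma> \<delta> :: real
  assumes A: "A \<subseteq> E" and \<gamma>: "0 < \<gamma>" "\<gamma> < 1" and \<delta>: "0 \<le> \<delta>" "real k * \<delta> \<le> 1"
  shows "log k (card C) \<le> real (card A)
     + real (card E) * (log k (1 / (1 - \<gamma>)) + k * \<delta> * log k (k / \<gamma>))
     + (\<Sum>c\<in>C. \<Sum>e\<in>E. log k (card (likely_colours \<delta> A c e))) / card C"
proof -
  define L where "L = likely_colours \<delta> A"
  \<comment> \<open>Reveal \<open>c\<close> on \<open>A\<close> uniformly, then colour the edges independently by \<open>q0\<close>, which is mostly
    uniform on the likely colours but keeps every colour possible, so that its logarithm is bounded.\<close>
  define q0 where "q0 c e a = (1 - \<gamma>) * of_bool (a \<in> L c e) / real (card (L c e)) + \<gamma> / k" for c e a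
  define q where "q c = (1 / real k) ^ card A * (\<Prod>e\<in>E. q0 c e (c e))" for c
  have finA: "finite A" using A finite_E finite_subset by blast
  have L_pos: "0 < card (L c e)" if "c \<in> C" "e \<in> E" for c e
    using likely_colours_nonempty[OF that \<delta>(2)] finite_likely_colours
    by (simp add: L_def card_gt_0_iff)
  have k: "1 < real k" using k_ge_2 by simp
  have q0_pos: "0 < q0 c e a" for c e a
    unfolding q0_def using \<gamma> k by (intro add_nonneg_pos) auto
  have q0_sum: "(\<Sum>a\<in>{1..k}. q0 c e a) = 1" if "c \<in> C" "e \<in> E" for c e
  proof -
    have "{1..k} \<inter> L c e = L c e" by (auto simp: L_def likely_colours_def)
    then have "(\<Sum>a\<in>{1..k}. of_bool (a \<in> L c e) :: real) = card (L c e)"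
      by (simp add: of_bool_def sum.If_cases)
    then show ?thesis
      using L_pos[OF that] k
      by (simp add: q0_def sum.distrib sum_distrib_left[symmetric] sum_divide_distrib[symmetric])
  qed
  have q_sum: "(\<Sum>c\<in>C. q c) \<le> 1"
  proof -
    have sub: "(\<lambda>c. restrict c A) ` C \<subseteq> A \<rightarrow>\<^sub>E {1..k}"
      using C_colour A by auto
    \<comment> \<open>Colourings with the same restriction to \<open>A\<close> share the same likely
      colours, hence the same \<open>q0\<close>. Their products then sum to at most the total mass
      of one product measure, which is \<open>1\<close>.\<close>
    have "(\<Sum>c\<in>C. q c) = (\<Sum>\<psi>\<in>A \<rightarrow>\<^sub>E {1..k}. \<Sum>c | c \<in> C \<and> restrict c A = \<psi>. q c)"
      using finite_C finA sub by (intro sum.group[symmetric] finite_PiE) auto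
    also have "\<dots> \<le> (\<Sum>\<psi>\<in>A \<rightarrow>\<^sub>E {1..k}. (1 / real k) ^ card A)"
    proof (rule sum_mono)
      fix \<psi>
      let ?S = "{c \<in> C. restrict c A = \<psi>}"
      show "(\<Sum>c\<in>?S. q c) \<le> (1 / real k) ^ card A"
      proof (cases "?S = {}")
        case False
        then obtain c0 where c0: "c0 \<in> C" "restrict c0 A = \<psi>" by auto
        have ag: "c \<in> agree A c0" if "c \<in> ?S" for c
          using that c0 by (auto simp: agree_def restrict_def fun_eq_iff split: if_splits)
        have "(\<Sum>c\<in>?S. \<Prod>e\<in>E. q0 c e (c e)) = (\<Sum>c\<in>?S. \<Prod>e\<in>E. q0 c0 e (c e))"
        proof (intro sum.cong refl prod.cong)
          fix c e assume "c \<in> ?S"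
          then have "L c e = L c0 e" using likely_colours_agree[OF ag] by (simp add: L_def)
          then show "q0 c e (c e) = q0 c0 e (c e)" by (simp add: q0_def)
        qed
        also have "\<dots> \<le> (\<Sum>c\<in>E \<rightarrow>\<^sub>E {1..k}. \<Prod>e\<in>E. q0 c0 e (c e))"
          using C_sub finite_E q0_pos
          by (intro sum_mono2 finite_PiE prod_nonneg) (auto intro: less_imp_le)
        also have "\<dots> = (\<Prod>e\<in>E. \<Sum>a\<in>{1..k}. q0 c0 e a)"
          by (rule prod_sum_PiE[symmetric]) (use finite_E in auto)
        also have "\<dots> = 1" using q0_sum[OF c0(1)] by simp
        finally show ?thesis
          using k by (simp add: q_def sum_distrib_left[symmetric] mult_left_le)
      next
        case True
        show ?thesis unfolding True by simp
      qed
    qed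
    also have "\<dots> = 1" using finA k by (simp add: card_PiE power_one_over)
    finally show ?thesis .
  qed
  \<comment> \<open>A likely colour has \<open>q0\<close> at least
    \<open>(1 - \<gamma>) / card (L c e)\<close>; an unlikely one has \<open>q0\<close> equal to
    \<open>\<gamma> / k\<close>.\<close>
  have q0_log: "log k (1 / q0 c e (c e)) \<le> log k (card (L c e)) + log k (1 / (1 - \<gamma>))
      + of_bool (c e \<notin> L c e) * log k (k / \<gamma>)" if "c \<in> C" "e \<in> E" for c e
  proof (cases "c e \<in> L c e")
    case True
    then have "(1 - \<gamma>) / card (L c e) \<le> q0 c e (c e)" using \<gamma> by (simp add: q0_def)
    then have "1 / q0 c e (c e) \<le> 1 / ((1 - \<gamma>) / card (L c e))"
      using \<gamma> L_pos[OF that]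
      by (intro divide_left_mono mult_pos_pos divide_pos_pos q0_pos) auto
    also have "\<dots> = card (L c e) * (1 / (1 - \<gamma>))" by simp
    finally have "log k (1 / q0 c e (c e)) \<le> log k (card (L c e) * (1 / (1 - \<gamma>)))"
      using k q0_pos by (intro log_mono) auto
    also have "\<dots> = log k (card (L c e)) + log k (1 / (1 - \<gamma>))"
      using L_pos[OF that] \<gamma> k by (subst log_mult) auto
    finally show ?thesis using True by simp
  next
    case False
    have "log k (1 / q0 c e (c e)) = log k (k / \<gamma>)" using False by (simp add: q0_def)
    moreover have "0 \<le> log k (card (L c e))" using L_pos[OF that] k by simp
    moreover have "0 \<le> log k (1 / (1 - \<gamma>))" using \<gamma> k by simp
    ultimately show ?thesis using False by simp
  qed
  have q_log: "log k (1 / q c) = card A + (\<Sum>e\<in>E. log k (1 / q0 c e (c e)))" for c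
  proof -
    have pos: "0 < (\<Prod>e\<in>E. 1 / q0 c e (c e))" by (intro prod_pos) (use q0_pos in auto)
    have "1 / q c = real k ^ card A * (\<Prod>e\<in>E. 1 / q0 c e (c e))"
      by (simp add: q_def power_one_over prod_dividef)
    then have "log k (1 / q c) = log k (real k ^ card A) + log k (\<Prod>e\<in>E. 1 / q0 c e (c e))"
      using pos k by (simp add: log_mult)
    also have "log k (\<Prod>e\<in>E. 1 / q0 c e (c e)) = (\<Sum>e\<in>E. log k (1 / q0 c e (c e)))"
      unfolding log_def using less_imp_neq[OF q0_pos] finite_E
      by (subst ln_prod) (auto simp: sum_divide_distrib)
    finally show ?thesis using k by (simp add: log_nat_power)
  qed
  have "log k (card C) \<le> (\<Sum>c\<in>C. log k (1 / q c)) / card C"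
    using k q0_pos by (intro log_card_le_average finite_C C_nonempty q_sum)
      (auto simp: q_def intro!: mult_pos_pos prod_pos)
  also have "(\<Sum>c\<in>C. log k (1 / q c)) \<le> (\<Sum>c\<in>C. card A + (\<Sum>e\<in>E. log k (card (L c e))
      + log k (1 / (1 - \<gamma>)) + of_bool (c e \<notin> L c e) * log k (k / \<gamma>)))"
    unfolding q_log by (intro sum_mono add_left_mono q0_log)
  also have "\<dots> = card C * real (card A) + (\<Sum>c\<in>C. \<Sum>e\<in>E. log k (card (L c e)))
      + card C * (card E * log k (1 / (1 - \<gamma>)))
      + (\<Sum>e\<in>E. \<Sum>c\<in>C. of_bool (c e \<notin> L c e)) * log k (k / \<gamma>)"
    by (simp add: sum.distrib sum_distrib_right sum.swap[of _ E])
  also have "\<dots> \<le> card C * real (card A) + (\<Sum>c\<in>C. \<Sum>e\<in>E. log k (card (L c e)))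
      + card C * (card E * log k (1 / (1 - \<gamma>)))
      + (\<Sum>e\<in>E. real (card C) * (real k * \<delta>)) * log k (k / \<gamma>)"
  proof (intro add_left_mono mult_right_mono sum_mono)
    show "0 \<le> log k (k / \<gamma>)" using \<gamma> k by (simp add: field_simps)
  qed (use sum_unlikely_le \<delta> in \<open>auto simp: L_def\<close>)
  finally show ?thesis
    using card_C_pos by (simp add: L_def divide_right_mono field_simps)
qed

section \<open>Averaging over a regular system of sets\<close>

text \<open>The sets \<open>Q i\<close> abstract the subcubes of a fixed dimension: each has
  \<open>r\<close> elements, each \<open>e\<close> lies in \<open>\<Delta>\<close> of them, and few
  pairs through \<open>e\<close> meet elsewhere. Where the discrepancy is small, the likely colours
  satisfy the premises of \<open>local\<close>; elsewhere the trivial bound \<open>r\<close> is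
  charged to the discrepancy, whose average over \<open>R\<close> is small.\<close>

lemma log_card_le_density:
  fixes \<gamma> \<delta> p u \<kappa> \<rho> :: real and r \<Delta> :: nat and I :: "'i set" and Q :: "'i \<Rightarrow> 'e set"
  assumes I: "finite I"
    and Q: "\<And>i. i \<in> I \<Longrightarrow> Q i \<subseteq> E" "\<And>i. i \<in> I \<Longrightarrow> card (Q i) = r"
    and degree: "\<And>e. e \<in> E \<Longrightarrow> card {i \<in> I. e \<in> Q i} = \<Delta>" and \<Delta>: "0 < \<Delta>"
    and codegree: "\<And>e. e \<in> E \<Longrightarrow>
      real (card {(i, j). i \<in> I \<and> j \<in> I \<and> e \<in> Q i \<and> e \<in> Q j \<and> Q i \<inter> Q j \<noteq> {e}}) \<le> \<kappa> * real \<Delta> ^ 2"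
    and \<rho>: "0 \<le> \<rho>"
    and local: "\<And>i t. i \<in> I \<Longrightarrow> (\<And>e. e \<in> Q i \<Longrightarrow> t e \<subseteq> {1..k} \<and> t e \<noteq> {}) \<Longrightarrow>
      (\<And>x. (\<And>e. e \<in> Q i \<Longrightarrow> x e \<in> t e) \<Longrightarrow> \<exists>c\<in>C. \<forall>e\<in>Q i. c e = x e) \<Longrightarrow>
      (\<Sum>e\<in>Q i. log k (card (t e))) \<le> \<rho> * r"
    and p: "0 < p" "p \<le> 1" and u: "0 < u" and \<gamma>: "0 < \<gamma>" "\<gamma> < 1"
    and \<delta>: "0 < \<delta>" "real k * \<delta> \<le> 1"
  shows "log k (card C) \<le> card E * (\<rho> + p + log k (1 / (1 - \<gamma>)) + k * \<delta> * log k (k / \<gamma>)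
      + r * (u + \<kappa> / (p ^ (r - 1) * u)) / (\<delta> / 2) ^ (2 * r))"
proof -
  define \<theta> where "\<theta> = (\<delta> / 2) ^ (2 * r)"
  define \<eta> where "\<eta> = u + \<kappa> / (p ^ (r - 1) * u)"
  define \<Lambda> where "\<Lambda> = log k (1 / (1 - \<gamma>)) + k * \<delta> * log k (k / \<gamma>)"
  define L where "L = likely_colours \<delta>"
  \<comment> \<open>By \<open>sum_discrepancy\<close>, this is the sum over \<open>i\<close> of the
    mean of \<open>discrepancy R (Q i)\<close> over \<open>C\<close>.\<close>
  define X where "X R = (\<Sum>i\<in>I. \<Sum>e\<in>Q i. energy e (R \<union> (Q i - {e})) - energy e R)" for R
  let ?B = "bernoulli_avg p E"
  have k: "1 < real k" using k_ge_2 by simp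
  have \<theta>: "0 < \<theta>" using \<delta> by (simp add: \<theta>_def)
  have \<delta>1: "\<delta> \<le> 1" using mult_right_mono[of 1 "real k" \<delta>] k \<delta> by linarith
  have L_pos: "0 < card (L R c e)" if "c \<in> C" "e \<in> E" for R c e
    using likely_colours_nonempty[OF that \<delta>(2)] finite_likely_colours
    by (simp add: L_def card_gt_0_iff)
  have L_sub: "L R c e \<subseteq> {1..k}" for R c e
    by (auto simp: L_def likely_colours_def)
  \<comment> \<open>A pointwise Markov argument: when the discrepancy exceeds
    \<open>\<theta>\<close>, the second term alone is at least \<open>r\<close>.\<close>
  have subcube: "(\<Sum>e\<in>Q i. log k (card (L R c e))) \<le> \<rho> * r + r / \<theta> * discrepancy R (Q i) c"
    if i: "i \<in> I" and c: "c \<in> C" for i R c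
  proof (cases "discrepancy R (Q i) c \<le> \<theta>")
    case True
    have "(\<Sum>e\<in>Q i. log k (card (L R c e))) \<le> \<rho> * r"
    proof (rule local[OF i])
      show "L R c e \<subseteq> {1..k} \<and> L R c e \<noteq> {}" if "e \<in> Q i" for e
        using L_sub L_pos[OF c, of e R] Q(1)[OF i] that by auto
      show "\<exists>c\<in>C. \<forall>e\<in>Q i. c e = x e" if "\<And>e. e \<in> Q i \<Longrightarrow> x e \<in> L R c e" for x
        using realised_if_discrepancy_small[of "Q i" c \<delta> R x] that True c \<delta> \<delta>1 Q[OF i]
          finite_E finite_subset agree_subset
        unfolding L_def \<theta>_def by (metis subsetD)
    qed
    then show ?thesis using \<theta> discrepancy_nonneg[of R "Q i" c] by (simp add: add_increasing2)
  next
    case False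
    have "(\<Sum>e\<in>Q i. log k (card (L R c e))) \<le> (\<Sum>e\<in>Q i. 1)"
    proof (rule sum_mono)
      fix e assume "e \<in> Q i"
      then have "e \<in> E" using Q(1)[OF i] by auto
      have "card (L R c e) \<le> k" using card_mono[OF _ L_sub, of R c e] by simp
      then show "log k (card (L R c e)) \<le> 1"
        using L_pos[OF c \<open>e \<in> E\<close>, of R] k by (simp add: log_le_one_cancel_iff)
    qed
    also have "\<dots> = r / \<theta> * \<theta>" using Q(2)[OF i] \<theta> by simp
    also have "\<dots> \<le> r / \<theta> * discrepancy R (Q i) c"
      using False \<theta> by (intro mult_left_mono) auto
    also have "\<dots> \<le> \<rho> * r + r / \<theta> * discrepancy R (Q i) c" using \<rho> by simp
    finally show ?thesis .
  qed
  have incidence: "(\<Sum>i\<in>I. \<Sum>e\<in>Q i. g e) = \<Delta> * (\<Sum>e\<in>E. g e)" for g :: "'e \<Rightarrow> real"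
  proof -
    have "(\<Sum>i\<in>I. \<Sum>e\<in>Q i. g e) = (\<Sum>e\<in>E. \<Sum>i | i \<in> I \<and> e \<in> Q i. g e)"
      by (rule sum_incidence[OF I finite_E Q(1)])
    then show ?thesis using degree by (simp add: sum_distrib_left)
  qed
  have card_I: "real (card I) * r = \<Delta> * card E"
    using incidence[of "\<lambda>_. 1"] Q(2) by simp
  \<comment> \<open>Every edge lies in exactly \<open>\<Delta>\<close> of the sets, so the entropy
    over \<open>E\<close> is \<open>1 / \<Delta>\<close> times the sum of the entropies over the
    \<open>Q i\<close>.\<close>
  have bound: "log k (card C) \<le> real (card R) + (card E * (\<Lambda> + \<rho>) + r / (\<theta> * \<Delta>) * X R)"
    if R: "R \<subseteq> E" for R
  proof -
    have "\<Delta> * (\<Sum>c\<in>C. \<Sum>e\<in>E. log k (card (L R c e)))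
        = (\<Sum>c\<in>C. \<Sum>i\<in>I. \<Sum>e\<in>Q i. log k (card (L R c e)))"
      unfolding incidence by (simp add: sum_distrib_left)
    also have "\<dots> \<le> (\<Sum>c\<in>C. \<Sum>i\<in>I. \<rho> * r + r / \<theta> * discrepancy R (Q i) c)"
      by (intro sum_mono subcube)
    also have "\<dots> = card C * (\<rho> * (real (card I) * r)) + r / \<theta> * (\<Sum>i\<in>I. \<Sum>c\<in>C. discrepancy R (Q i) c)"
      by (simp add: sum.distrib sum_distrib_left sum.swap[of _ I] mult_ac)
    also have "\<dots> = card C * (\<rho> * (\<Delta> * card E) + r / \<theta> * X R)"
      unfolding sum_discrepancy card_I X_def by (simp add: sum_distrib_left[symmetric] algebra_simps)
    finally have "(\<Sum>c\<in>C. \<Sum>e\<in>E. log k (card (L R c e))) / card C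
        \<le> card E * \<rho> + r / (\<theta> * \<Delta>) * X R"
      using card_C_pos \<Delta> \<theta> by (simp add: field_simps)
    moreover have "log k (card C) \<le> real (card R) + card E * \<Lambda>
        + (\<Sum>c\<in>C. \<Sum>e\<in>E. log k (card (L R c e))) / card C"
      unfolding \<Lambda>_def L_def using \<gamma> \<delta> R by (intro log_card_le_likely_colours) auto
    ultimately show ?thesis by (simp add: distrib_left)
  qed
  \<comment> \<open>For fixed \<open>e\<close>, \<open>bernoulli_avg_adjoin_le\<close> applies to
    \<open>energy e\<close> and the sets \<open>Q i - {e}\<close>, whose intersecting pairs are
    those counted by \<open>codegree\<close>.\<close>
  have BX: "?B X \<le> card E * (\<Delta> * \<eta>)"
  proof -
    have "?B X = (\<Sum>i\<in>I. \<Sum>e\<in>Q i. ?B (\<lambda>R. energy e (R \<union> (Q i - {e}))) - ?B (energy e))"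
      unfolding X_def bernoulli_avg_sum bernoulli_avg_diff ..
    also have "\<dots> = (\<Sum>e\<in>E. \<Sum>i | i \<in> I \<and> e \<in> Q i.
        ?B (\<lambda>R. energy e (R \<union> (Q i - {e}))) - ?B (energy e))"
      by (rule sum_incidence[OF I finite_E Q(1)])
    also have "\<dots> \<le> (\<Sum>e\<in>E. \<Delta> * \<eta>)"
    proof (rule sum_mono)
      fix e assume e: "e \<in> E"
      let ?J = "{i \<in> I. e \<in> Q i}"
      have "(\<Sum>i\<in>?J. ?B (\<lambda>R. energy e (R \<union> (Q i - {e}))) - ?B (energy e))
          \<le> real (card ?J) * (u + \<kappa> / (p ^ (r - 1) * u))"
      proof (rule bernoulli_avg_adjoin_le[OF finite_E _ _ _ _ p u])
        show "?J \<noteq> {}" using degree[OF e] \<Delta> by (metis card.empty less_irrefl)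
        have "{(i, j). i \<in> ?J \<and> j \<in> ?J \<and> (Q i - {e}) \<inter> (Q j - {e}) \<noteq> {}}
            = {(i, j). i \<in> I \<and> j \<in> I \<and> e \<in> Q i \<and> e \<in> Q j \<and> Q i \<inter> Q j \<noteq> {e}}"
          by blast
        then show "real (card {(i, j). i \<in> ?J \<and> j \<in> ?J \<and> (Q i - {e}) \<inter> (Q j - {e}) \<noteq> {}})
            \<le> \<kappa> * real (card ?J) ^ 2"
          using codegree[OF e] degree[OF e] by simp
        show "card (Q i - {e}) = r - 1" if "i \<in> ?J" for i
          using that Q(2) by simp
      qed (use I Q energy_nonneg energy_le_1[OF e] in auto)
      then show "(\<Sum>i\<in>?J. ?B (\<lambda>R. energy e (R \<union> (Q i - {e}))) - ?B (energy e)) \<le> \<Delta> * \<eta>"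
        using degree[OF e] by (simp add: \<eta>_def)
    qed
    finally show ?thesis by simp
  qed
  \<comment> \<open>The left-hand side is constant in \<open>R\<close>, so \<open>bound\<close> can
    be averaged over \<open>R\<close>; revealing \<open>R\<close> costs \<open>p * card E\<close> on
    average.\<close>
  have "log k (card C) = ?B (\<lambda>R. log k (card C))"
    using finite_E by (simp add: bernoulli_avg_const)
  also have "\<dots> \<le> ?B (\<lambda>R. real (card R) + (card E * (\<Lambda> + \<rho>) + r / (\<theta> * \<Delta>) * X R))"
    by (rule bernoulli_avg_mono) (use p bound in auto)
  also have "\<dots> = p * card E + (card E * (\<Lambda> + \<rho>) + r / (\<theta> * \<Delta>) * ?B X)"
    unfolding bernoulli_avg_add bernoulli_avg_cmult bernoulli_avg_const[OF finite_E]
      bernoulli_avg_card[OF finite_E] ..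
  also have "\<dots> \<le> p * card E + (card E * (\<Lambda> + \<rho>) + r / (\<theta> * \<Delta>) * (card E * (\<Delta> * \<eta>)))"
    using BX \<theta> by (intro add_left_mono mult_left_mono) auto
  also have "\<dots> = card E * (\<rho> + p + \<Lambda> + r * \<eta> / \<theta>)"
    using \<Delta> \<theta> by (simp add: field_simps)
  finally show ?thesis by (simp add: \<Lambda>_def \<eta>_def \<theta>_def add.assoc)
qed

end

subsection \<open>Subcubes of the hypercube\<close>

text \<open>The edge through \<open>x\<close> in direction \<open>d\<close>; either endpoint may
  serve as \<open>x\<close>.\<close>

definition cube_edge :: "(nat \<Rightarrow> nat) \<Rightarrow> nat \<Rightarrow> (nat \<Rightarrow> nat) set" where
  "cube_edge x d = {x(d := 0), x(d := 1)}"

text \<open>The direction is recovered as the only coordinate in which the endpoints differ, and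
  every other coordinate is constant on the edge.\<close>

lemma cube_edge_eq_iff: "cube_edge x d = cube_edge y d' \<longleftrightarrow> d = d' \<and> (\<forall>i. i \<noteq> d \<longrightarrow> x i = y i)"
proof
  have dirs: "{i. \<exists>u\<in>cube_edge x d. \<exists>v\<in>cube_edge x d. u i \<noteq> v i} = {d}" for x d
    by (auto simp: cube_edge_def)
  have vals: "i \<noteq> d \<Longrightarrow> u \<in> cube_edge x d \<Longrightarrow> u i = x i" for x d i u
    by (auto simp: cube_edge_def)
  assume eq: "cube_edge x d = cube_edge y d'"
  then have "d = d'" using dirs[of x d] dirs[of y d'] by simp
  moreover have "x i = y i" if "i \<noteq> d" for i
  proof -
    have "x(d := 0) \<in> cube_edge x d" by (simp add: cube_edge_def)
    then have "x(d := 0) \<in> cube_edge y d" using eq \<open>d = d'\<close> by simp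
    then have "(x(d := 0)) i = y i" by (rule vals[OF that])
    then show ?thesis using that by simp
  qed
  ultimately show "d = d' \<and> (\<forall>i. i \<noteq> d \<longrightarrow> x i = y i)" by blast
next
  assume "d = d' \<and> (\<forall>i. i \<noteq> d \<longrightarrow> x i = y i)"
  then have "x(d := a) = y(d' := a)" for a by auto
  then show "cube_edge x d = cube_edge y d'" by (simp add: cube_edge_def)
qed

lemma cube_verts_upd: "x \<in> cube_verts n \<Longrightarrow> d \<in> {1..n} \<Longrightarrow> a \<in> {0, 1} \<Longrightarrow> x(d := a) \<in> cube_verts n"
  by (auto simp: cube_verts_def PiE_iff extensional_def)

lemma cube_verts_outside: "x \<in> cube_verts n \<Longrightarrow> l \<notin> {1..n} \<Longrightarrow> x l = undefined"
  unfolding cube_verts_def by (rule PiE_arb)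

lemma cube_verts_eqI:
  assumes "x \<in> cube_verts n" "y \<in> cube_verts n" "\<And>i. i \<in> {1..n} \<Longrightarrow> x i = y i"
  shows "x = y"
  using assms unfolding cube_verts_def by (rule PiE_ext)

lemma cube_edges_eq: "cube_edges n = {cube_edge x d | x d. x \<in> cube_verts n \<and> d \<in> {1..n}}"
proof (intro equalityI subsetI)
  fix e assume "e \<in> cube_edges n"
  then obtain x y where xy: "e = {x, y}" "x \<in> cube_verts n" "y \<in> cube_verts n"
    "card {i \<in> {1..n}. x i \<noteq> y i} = 1"
    unfolding cube_edges_def by blast
  then obtain d where d: "{i \<in> {1..n}. x i \<noteq> y i} = {d}" by (auto simp: card_1_singleton_iff)
  then have d': "d \<in> {1..n}" "x d \<noteq> y d" by auto
  have vals: "x d \<in> {0, 1}" "y d \<in> {0, 1}"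
    using xy(2,3) d'(1) unfolding cube_verts_def by (blast dest: PiE_mem)+
  have same: "x l = y l" if "l \<in> {1..n}" "l \<noteq> d" for l
    using d that by blast
  have y: "y = x(d := y d)"
    by (rule cube_verts_eqI[OF xy(3) cube_verts_upd[OF xy(2) d'(1) vals(2)]]) (use same in auto)
  have "(x d = 0 \<and> y d = 1) \<or> (x d = 1 \<and> y d = 0)"
    using vals d'(2) by auto
  then have "(x = x(d := 0) \<and> y = x(d := 1)) \<or> (x = x(d := 1) \<and> y = x(d := 0))"
    using y by (metis fun_upd_triv)
  then have "e = cube_edge x d"
    unfolding cube_edge_def xy(1)
  proof
    assume xy': "x = x(d := 0) \<and> y = x(d := 1)"
    show "{x, y} = {x(d := 0), x(d := 1)}"
      by (rule arg_cong2[where f = "\<lambda>u v. {u, v}"]) (use xy' in blast)+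
  next
    assume xy': "x = x(d := 1) \<and> y = x(d := 0)"
    have "{x, y} = {x(d := 1), x(d := 0)}"
      by (rule arg_cong2[where f = "\<lambda>u v. {u, v}"]) (use xy' in blast)+
    then show "{x, y} = {x(d := 0), x(d := 1)}" by (simp only: insert_commute)
  qed
  then show "e \<in> {cube_edge x d | x d. x \<in> cube_verts n \<and> d \<in> {1..n}}" using xy d' by blast
next
  fix e assume "e \<in> {cube_edge x d | x d. x \<in> cube_verts n \<and> d \<in> {1..n}}"
  then obtain x d where e: "e = cube_edge x d" "x \<in> cube_verts n" "d \<in> {1..n}" by blast
  have "{i \<in> {1..n}. (x(d := 0)) i \<noteq> (x(d := 1)) i} = {d}" using e by auto
  then have "card {i \<in> {1..n}. (x(d := 0)) i \<noteq> (x(d := 1)) i} = 1" by simp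
  moreover have "x(d := 0) \<in> cube_verts n" "x(d := 1) \<in> cube_verts n"
    using e by (auto intro!: cube_verts_upd)
  ultimately show "e \<in> cube_edges n"
    unfolding cube_edges_def e(1) cube_edge_def by blast
qed

lemma finite_cube_edges: "finite (cube_edges n)"
proof -
  have "finite (cube_verts n)" by (simp add: cube_verts_def finite_PiE)
  then have "finite ((\<lambda>(x, d). cube_edge x d) ` (cube_verts n \<times> {1..n}))" by auto
  then show ?thesis by (rule finite_subset[rotated]) (auto simp: cube_edges_eq)
qed

text \<open>Choosing the endpoint with \<open>x d = 0\<close> counts each edge of direction
  \<open>d\<close> once.\<close>

lemma card_cube_edges: "card (cube_edges n) = n * 2 ^ (n - 1)"
proof -
  let ?V = "\<lambda>d. {x \<in> cube_verts n. x d = 0}"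
  have V: "card (?V d) = 2 ^ (n - 1)" if d: "d \<in> {1..n}" for d
  proof -
    have "?V d = (\<Pi>\<^sub>E i\<in>{1..n}. if i = d then {0} else {0, 1})"
    proof (intro set_eqI iffI)
      fix x assume x: "x \<in> ?V d"
      show "x \<in> (\<Pi>\<^sub>E i\<in>{1..n}. if i = d then {0} else {0, 1})"
      proof (rule PiE_I)
        fix i assume "i \<in> {1..n}"
        then show "x i \<in> (if i = d then {0} else {0, 1})"
          using x PiE_mem[of x "{1..n}" "\<lambda>_. {0, 1}" i] by (simp add: cube_verts_def)
      next
        fix i assume "i \<notin> {1..n}"
        then show "x i = undefined" using x cube_verts_outside by blast
      qed
    next
      fix x :: "nat \<Rightarrow> nat"
      assume x: "x \<in> (\<Pi>\<^sub>E i\<in>{1..n}. if i = d then {0} else {0, 1})"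
      have "x d = 0" using PiE_mem[OF x d] by simp
      moreover have "x \<in> cube_verts n"
        unfolding cube_verts_def
      proof (rule PiE_I)
        fix i assume "i \<in> {1..n}"
        then show "x i \<in> {0, 1}" using PiE_mem[OF x, of i] by (simp split: if_splits)
      next
        fix i assume "i \<notin> {1..n}"
        then show "x i = undefined" using PiE_arb[OF x] by blast
      qed
      ultimately show "x \<in> ?V d" by simp
    qed
    then have "card (?V d) = (\<Prod>i\<in>{1..n}. if i = d then 1 else 2)"
      by (simp add: card_PiE if_distrib numeral_2_eq_2 cong: if_cong)
    also have "\<dots> = (\<Prod>i\<in>{1..n} - {d}. 2)"
      using d by (subst prod.remove[of _ d]) (auto intro!: prod.cong)
    finally show ?thesis using d by simp
  qed
  have fin: "finite (?V d)" for d by (simp add: cube_verts_def finite_PiE)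
  have "cube_edges n = (\<Union>d\<in>{1..n}. (\<lambda>x. cube_edge x d) ` ?V d)"
  proof (intro equalityI subsetI)
    fix e assume "e \<in> cube_edges n"
    then obtain x d where e: "e = cube_edge x d" "x \<in> cube_verts n" "d \<in> {1..n}"
      by (auto simp: cube_edges_eq)
    have "cube_edge x d = cube_edge (x(d := 0)) d" by (simp add: cube_edge_eq_iff)
    moreover have "x(d := 0) \<in> ?V d" using e by (simp add: cube_verts_upd)
    ultimately show "e \<in> (\<Union>d\<in>{1..n}. (\<lambda>x. cube_edge x d) ` ?V d)" using e by blast
  next
    fix e assume "e \<in> (\<Union>d\<in>{1..n}. (\<lambda>x. cube_edge x d) ` ?V d)"
    then show "e \<in> cube_edges n" unfolding cube_edges_eq by blast
  qed
  also have "card \<dots> = (\<Sum>d\<in>{1..n}. card ((\<lambda>x. cube_edge x d) ` ?V d))"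
    using fin by (intro card_UN_disjoint) (auto simp: cube_edge_eq_iff)
  also have "\<dots> = (\<Sum>d\<in>{1..n}. 2 ^ (n - 1))"
  proof (intro sum.cong refl)
    fix d assume "d \<in> {1..n}"
    moreover have "inj_on (\<lambda>x. cube_edge x d) (?V d)"
      by (auto simp: inj_on_def cube_edge_eq_iff fun_eq_iff) metis
    ultimately show "card ((\<lambda>x. cube_edge x d) ` ?V d) = 2 ^ (n - 1)"
      using V by (simp add: card_image)
  qed
  finally show ?thesis by simp
qed

text \<open>
  A subcube is given by its set \<open>D\<close> of active coordinates and by its vertex \<open>z\<close> vanishing on \<open>D\<close>,
  which makes the representation unique.
\<close>

definition subcubes :: "nat \<Rightarrow> nat \<Rightarrow> (nat set \<times> (nat \<Rightarrow> nat)) set" where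
  "subcubes m n = {(D, z). D \<subseteq> {1..n} \<and> card D = m \<and> z \<in> cube_verts n \<and> (\<forall>i\<in>D. z i = 0)}"

definition subcube_edges :: "nat \<Rightarrow> nat set \<times> (nat \<Rightarrow> nat) \<Rightarrow> (nat \<Rightarrow> nat) set set" where
  "subcube_edges n = (\<lambda>(D, z). {cube_edge x d | x d.
     x \<in> cube_verts n \<and> d \<in> D \<and> (\<forall>i\<in>{1..n} - D. x i = z i)})"

lemma finite_subcubes: "finite (subcubes m n)"
  by (rule finite_subset[of _ "Pow {1..n} \<times> cube_verts n"])
    (auto simp: subcubes_def cube_verts_def finite_PiE)

lemma subcube_edges_subset: "i \<in> subcubes m n \<Longrightarrow> subcube_edges n i \<subseteq> cube_edges n"
  unfolding subcubes_def subcube_edges_def cube_edges_eq by clarsimp (metis atLeastAtMost_iff subsetD)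

lemma cube_edge_in_subcube_iff:
  assumes "x \<in> cube_verts n" "(D, z) \<in> subcubes m n"
  shows "cube_edge x d \<in> subcube_edges n (D, z) \<longleftrightarrow> d \<in> D \<and> (\<forall>i\<in>{1..n} - D. x i = z i)"
  using assms by (auto simp: subcube_edges_def subcubes_def cube_edge_eq_iff)

section \<open>Counting subcubes through an edge\<close>

lemma card_supersets:
  assumes "finite A" "F \<subseteq> A" "card F \<le> m"
  shows "card {D. D \<subseteq> A \<and> card D = m \<and> F \<subseteq> D} = (card A - card F) choose (m - card F)"
proof -
  have finF: "finite F" using assms finite_subset by blast
  have "bij_betw (\<lambda>D. D - F) {D. D \<subseteq> A \<and> card D = m \<and> F \<subseteq> D}
      {D. D \<subseteq> A - F \<and> card D = m - card F}"
  proof (rule bij_betwI[where g = "\<lambda>D. D \<union> F"])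
    show "(\<lambda>D. D - F) \<in> {D. D \<subseteq> A \<and> card D = m \<and> F \<subseteq> D} \<rightarrow> {D. D \<subseteq> A - F \<and> card D = m - card F}"
      using finF by (auto simp: card_Diff_subset)
    show "(\<lambda>D. D \<union> F) \<in> {D. D \<subseteq> A - F \<and> card D = m - card F} \<rightarrow> {D. D \<subseteq> A \<and> card D = m \<and> F \<subseteq> D}"
    proof
      fix D assume D: "D \<in> {D. D \<subseteq> A - F \<and> card D = m - card F}"
      then have "finite D" "D \<inter> F = {}" using assms(1) finite_subset by blast+
      then have "card (D \<union> F) = m" using D finF assms(3) by (simp add: card_Un_disjoint)
      then show "D \<union> F \<in> {D. D \<subseteq> A \<and> card D = m \<and> F \<subseteq> D}" using D assms(2) by auto
    qed
  qed auto
  then show ?thesis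
    using assms finF by (simp add: bij_betw_same_card n_subsets card_Diff_subset)
qed

text \<open>A subcube through a given edge is determined by its active set \<open>D\<close>, which
  must contain \<open>d\<close>: its base vertex is \<open>x\<close> set to zero on
  \<open>D\<close>.\<close>

lemma subcubes_containing_edge:
  assumes "x \<in> cube_verts n" "d \<in> {1..n}"
  shows "{i \<in> subcubes m n. cube_edge x d \<in> subcube_edges n i}
       = (\<lambda>D. (D, \<lambda>i. if i \<in> D then 0 else x i)) ` {D. D \<subseteq> {1..n} \<and> card D = m \<and> {d} \<subseteq> D}"
    (is "?L = ?f ` ?R")
proof (intro equalityI subsetI)
  fix i assume i: "i \<in> ?L"
  obtain D z where Dz: "i = (D, z)" by (cases i)
  then have D: "(D, z) \<in> subcubes m n" "d \<in> D" "\<forall>i\<in>{1..n} - D. x i = z i"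
    using i assms cube_edge_in_subcube_iff by auto
  have "z = (\<lambda>i. if i \<in> D then 0 else x i)"
    using D assms
    by (intro cube_verts_eqI[of z n])
      (auto simp: subcubes_def cube_verts_def PiE_iff extensional_def)
  then have "i = ?f D" using Dz by simp
  moreover have "D \<in> ?R" using D by (auto simp: subcubes_def)
  ultimately show "i \<in> ?f ` ?R" by blast
next
  fix i assume "i \<in> ?f ` ?R"
  then obtain D where D: "D \<subseteq> {1..n}" "card D = m" "d \<in> D" and i: "i = ?f D" by auto
  have "?f D \<in> subcubes m n"
    using D assms by (auto simp: subcubes_def cube_verts_def PiE_iff extensional_def)
  moreover from this have "cube_edge x d \<in> subcube_edges n (?f D)"
    using assms D by (subst cube_edge_in_subcube_iff) auto
  ultimately show "i \<in> ?L" using i by simp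
qed

lemma card_subcubes_containing_edge:
  assumes "e \<in> cube_edges n" "1 \<le> m"
  shows "card {i \<in> subcubes m n. e \<in> subcube_edges n i} = (n - 1) choose (m - 1)"
proof -
  obtain x d where e: "e = cube_edge x d" "x \<in> cube_verts n" "d \<in> {1..n}"
    using assms by (auto simp: cube_edges_eq)
  have "card {i \<in> subcubes m n. e \<in> subcube_edges n i}
      = card {D. D \<subseteq> {1..n} \<and> card D = m \<and> {d} \<subseteq> D}"
    unfolding e(1) subcubes_containing_edge[OF e(2,3)]
    by (rule card_image) (auto simp: inj_on_def)
  then show ?thesis using e assms by (subst (asm) card_supersets) auto
qed

text \<open>The direction of a common edge is active in both subcubes, so it is \<open>d\<close>.
  Any other coordinate is inactive in one of them and is fixed there to its value in
  \<open>x\<close>.\<close>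

lemma subcube_edges_inter:
  assumes "x \<in> cube_verts n" "i \<in> subcubes m n" "j \<in> subcubes m n"
    and "cube_edge x d \<in> subcube_edges n i" "cube_edge x d \<in> subcube_edges n j"
    and "fst i \<inter> fst j = {d}"
  shows "subcube_edges n i \<inter> subcube_edges n j = {cube_edge x d}"
proof (intro equalityI subsetI)
  fix f assume f: "f \<in> subcube_edges n i \<inter> subcube_edges n j"
  obtain D z where i: "i = (D, z)" by (cases i)
  obtain D' z' where j: "j = (D', z')" by (cases j)
  note ij = i j
  obtain y d' where y: "f = cube_edge y d'" "y \<in> cube_verts n" "d' \<in> D"
      "\<forall>l\<in>{1..n} - D. y l = z l"
    using f ij by (auto simp: subcube_edges_def)
  have y': "d' \<in> D'" "\<forall>l\<in>{1..n} - D'. y l = z' l"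
    using f y assms ij by (auto simp: cube_edge_in_subcube_iff)
  have x: "\<forall>l\<in>{1..n} - D. x l = z l" "\<forall>l\<in>{1..n} - D'. x l = z' l"
    using assms ij by (auto simp: cube_edge_in_subcube_iff)
  have "d' = d" using y y' assms ij by auto
  moreover have "y l = x l" if "l \<noteq> d" for l
  proof (cases "l \<in> {1..n}")
    case True
    then have "l \<notin> D \<or> l \<notin> D'" using that assms ij by auto
    then show ?thesis using True y y' x by auto
  next
    case False
    then show ?thesis using y(2) assms(1) cube_verts_outside by metis
  qed
  ultimately show "f \<in> {cube_edge x d}" using y by (auto simp: cube_edge_eq_iff)
qed (use assms in auto)

text \<open>Two subcubes through \<open>e\<close> share a further edge only if their active sets
  share a second coordinate \<open>d'\<close>. Choosing \<open>D\<close>, then \<open>d'\<close> in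
  \<open>D\<close>, then \<open>D'\<close> containing \<open>d\<close> and \<open>d'\<close> gives
  the count, a fraction of order \<open>1 / n\<close> of all pairs for fixed
  \<open>m\<close>.\<close>

lemma card_overlapping_subcubes:
  assumes "e \<in> cube_edges n" "1 \<le> m" "2 \<le> n"
  shows "real (card {(i, j). i \<in> subcubes m n \<and> j \<in> subcubes m n \<and>
             e \<in> subcube_edges n i \<and> e \<in> subcube_edges n j \<and>
             subcube_edges n i \<inter> subcube_edges n j \<noteq> {e}})
       \<le> real (m - 1) ^ 2 / real (n - 1) * real ((n - 1) choose (m - 1)) ^ 2"
proof -
  obtain x d where e: "e = cube_edge x d" "x \<in> cube_verts n" "d \<in> {1..n}"
    using assms by (auto simp: cube_edges_eq)
  define S where "S F = {D. D \<subseteq> {1..n} \<and> card D = m \<and> F \<subseteq> D}" for F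
  define f where "f D = (D, \<lambda>i. if i \<in> D then 0 else x i)" for D
  have finS: "finite (S F)" for F by (simp add: S_def)
  have fin: "finite D" if "D \<in> S F" for D F
    using that finite_subset by (auto simp: S_def)
  have containing: "{i \<in> subcubes m n. e \<in> subcube_edges n i} = f ` S {d}"
    unfolding e(1) subcubes_containing_edge[OF e(2,3)] S_def f_def ..
  let ?P = "Sigma (S {d}) (\<lambda>D. \<Union>d'\<in>D - {d}. S {d, d'})"
  have "{(i, j). i \<in> subcubes m n \<and> j \<in> subcubes m n \<and>
             e \<in> subcube_edges n i \<and> e \<in> subcube_edges n j \<and>
             subcube_edges n i \<inter> subcube_edges n j \<noteq> {e}}
      \<subseteq> (\<lambda>(D, D'). (f D, f D')) ` ?P" (is "?L \<subseteq> _")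
  proof
    fix ij assume "ij \<in> ?L"
    then obtain i j where ij: "ij = (i, j)" "i \<in> subcubes m n" "j \<in> subcubes m n"
      "e \<in> subcube_edges n i" "e \<in> subcube_edges n j"
      "subcube_edges n i \<inter> subcube_edges n j \<noteq> {e}" by blast
    then have "i \<in> f ` S {d}" "j \<in> f ` S {d}" using containing by blast+
    then obtain D D' where D: "i = f D" "j = f D'" "D \<in> S {d}" "D' \<in> S {d}" by blast
    have "fst i \<inter> fst j \<noteq> {d}" using subcube_edges_inter[OF e(2)] ij e(1) by blast
    moreover have "d \<in> D \<inter> D'" using D by (auto simp: S_def)
    ultimately obtain d' where "d' \<in> D \<inter> D'" "d' \<noteq> d" by (auto simp: D f_def)
    then have "(D, D') \<in> ?P" using D by (auto simp: S_def)
    then show "ij \<in> (\<lambda>(D, D'). (f D, f D')) ` ?P" using ij D by force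
  qed
  moreover have finP: "finite ?P" using finS fin by blast
  ultimately have "card ?L \<le> card ?P"
    by (meson card_image_le card_mono finite_imageI le_trans)
  also have "card ?P = (\<Sum>D\<in>S {d}. card (\<Union>d'\<in>D - {d}. S {d, d'}))"
    using finS fin by (intro card_SigmaI) blast+
  also have "\<dots> \<le> (\<Sum>D\<in>S {d}. (m - 1) * ((n - 2) choose (m - 2)))"
  proof (rule sum_mono)
    fix D assume D: "D \<in> S {d}"
    have "card (\<Union>d'\<in>D - {d}. S {d, d'}) \<le> (\<Sum>d'\<in>D - {d}. card (S {d, d'}))"
      using fin[OF D] by (intro card_UN_le) auto
    also have "\<dots> = (\<Sum>d'\<in>D - {d}. (n - 2) choose (m - 2))"
    proof (intro sum.cong refl)
      fix d' assume d': "d' \<in> D - {d}"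
      then have "card {d, d'} = 2" by auto
      moreover have "{d, d'} \<subseteq> D" using D d' by (auto simp: S_def)
      moreover from this have "card {d, d'} \<le> m"
        using D card_mono[OF fin[OF D], of "{d, d'}"] by (simp add: S_def)
      ultimately show "card (S {d, d'}) = (n - 2) choose (m - 2)"
        unfolding S_def using D by (subst card_supersets) (auto simp: S_def)
    qed
    also have "\<dots> = (m - 1) * ((n - 2) choose (m - 2))"
      using D fin[OF D] by (simp add: S_def)
    finally show "card (\<Union>d'\<in>D - {d}. S {d, d'}) \<le> (m - 1) * ((n - 2) choose (m - 2))" .
  qed
  also have "\<dots> = ((n - 1) choose (m - 1)) * ((m - 1) * ((n - 2) choose (m - 2)))"
  proof -
    have "card (S {d}) = (n - 1) choose (m - 1)"
      unfolding S_def using e assms by (subst card_supersets) auto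
    then show ?thesis by simp
  qed
  finally have le: "real (card ?L)
      \<le> real ((n - 1) choose (m - 1)) * (real (m - 1) * real ((n - 2) choose (m - 2)))"
    by (metis (no_types, lifting) of_nat_le_iff of_nat_mult)
  \<comment> \<open>Absorption for binomial coefficients; the factor \<open>m - 1\<close> settles
    the case \<open>m = 1\<close>, where \<open>m - 2\<close> is truncated.\<close>
  have "(m - 1) * ((n - 1) * ((n - 2) choose (m - 2))) = (m - 1) * ((m - 1) * ((n - 1) choose (m - 1)))"
  proof (cases "m = 1")
    case False
    then have "Suc (m - 2) = m - 1" using assms by auto
    moreover have "n - 1 - 1 = n - 2" by simp
    ultimately show ?thesis using binomial_absorption[of "m - 2" "n - 1"] by metis
  qed simp
  then have "real (m - 1) * (real (n - 1) * real ((n - 2) choose (m - 2)))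
      = real (m - 1) * (real (m - 1) * real ((n - 1) choose (m - 1)))"
    by (metis of_nat_mult)
  then have "real (m - 1) * real ((n - 2) choose (m - 2))
      = real (m - 1) ^ 2 / real (n - 1) * real ((n - 1) choose (m - 1))"
    using assms by (simp add: field_simps power2_eq_square)
  then show ?thesis using le by (simp add: power2_eq_square mult_ac)
qed

section \<open>Subcubes as images of order-preserving embeddings\<close>

text \<open>The embedding copies \<open>x\<close> along the increasing enumeration of
  \<open>D\<close> and follows \<open>z\<close> elsewhere. The bijection on edges allows templates
  and entropies to be transported.\<close>

lemma subcube_embedding:
  assumes "i \<in> subcubes m n"
  obtains \<phi> where "order_embedding m n \<phi>"
    "bij_betw ((`) \<phi>) (cube_edges m) (subcube_edges n i)"
proof -
  obtain D z where i: "i = (D, z)" by (cases i)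
  have D: "D \<subseteq> {1..n}" "card D = m" "z \<in> cube_verts n"
    using assms i by (auto simp: subcubes_def)
  have "finite D" using D(1) finite_subset by blast
  then obtain h where h: "bij_betw h {..<card D} D" "strict_mono_on {..<card D} h"
    by (rule ex_bij_betw_strict_mono_card)
  \<comment> \<open>The enumeration \<open>h\<close> starts at \<open>0\<close>, whereas coordinates
    start at \<open>1\<close>.\<close>
  define b where "b j = h (j - 1)" for j
  have "bij_betw (\<lambda>j. j - 1) {1..m} {..<m}"
    by (rule bij_betwI[where g = Suc]) auto
  then have bij: "bij_betw b {1..m} D"
    using bij_betw_trans h(1) D(2) unfolding b_def o_def[symmetric] by (metis comp_def ext)
  have mono: "strict_mono_on {1..m} b"
  proof (rule strict_mono_onI)
    fix r s assume "r \<in> {1..m}" "s \<in> {1..m}" "r < s"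
    then show "b r < b s"
      unfolding b_def using D(2) by (intro strict_mono_onD[OF h(2)]) auto
  qed
  define \<beta> where "\<beta> = the_inv_into {1..m} b"
  have b_\<beta>: "b (\<beta> l) = l" "\<beta> l \<in> {1..m}" if "l \<in> D" for l
    using that f_the_inv_into_f_bij_betw[OF bij] bij_betwE[OF bij_betw_the_inv_into[OF bij]]
    unfolding \<beta>_def by blast+
  have \<beta>_b: "\<beta> (b j) = j" "b j \<in> D" if "j \<in> {1..m}" for j
    using that bij unfolding \<beta>_def by (auto simp: bij_betw_def the_inv_into_f_f)
  define \<phi> where "\<phi> x l = (if l \<in> D then x (\<beta> l) else z l)" for x :: "nat \<Rightarrow> nat" and l
  have \<phi>_b: "\<phi> x (b j) = x j" if "j \<in> {1..m}" for x j
    using \<beta>_b[OF that] by (simp add: \<phi>_def)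
  have \<phi>_z: "\<phi> x l = z l" if "l \<notin> D" for x l using that by (simp add: \<phi>_def)
  have \<phi>_vert: "\<phi> x \<in> cube_verts n" if "x \<in> cube_verts m" for x
    unfolding cube_verts_def
  proof (rule PiE_I)
    fix l assume "l \<in> {1..n}"
    then have "z l \<in> {0, 1}" using D(3) unfolding cube_verts_def by (rule PiE_mem[rotated])
    moreover have "x (\<beta> l) \<in> {0, 1}" if "l \<in> D"
      using \<open>x \<in> cube_verts m\<close> b_\<beta>(2)[OF that] unfolding cube_verts_def by (rule PiE_mem)
    ultimately show "\<phi> x l \<in> {0, 1}" by (simp add: \<phi>_def)
  next
    fix l assume "l \<notin> {1..n}"
    then show "\<phi> x l = undefined" using D cube_verts_outside \<phi>_z by (metis subsetD)
  qed
  have \<phi>_upd: "\<phi> (x(j := a)) = (\<phi> x)(b j := a)" if "j \<in> {1..m}" for x j a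
  proof
    fix l show "\<phi> (x(j := a)) l = ((\<phi> x)(b j := a)) l"
      using that b_\<beta>[of l] \<beta>_b[of j] by (auto simp: \<phi>_def)
  qed
  have \<phi>_edge: "\<phi> ` cube_edge x j = cube_edge (\<phi> x) (b j)" if "j \<in> {1..m}" for x j
    by (simp add: cube_edge_def \<phi>_upd[OF that])
  have img: "b ` {1..m} = D" using bij by (simp add: bij_betw_def)
  have "order_embedding m n \<phi>"
    unfolding order_embedding_def
  proof (intro conjI exI[of _ b] ballI)
    show "\<phi> \<in> cube_verts m \<rightarrow> cube_verts n" using \<phi>_vert by blast
    show "strict_mono_on {1..m} b" by (rule mono)
    show "b ` {1..m} \<subseteq> {1..n}" using img D by simp
    show "\<phi> x (b j) = x j" if "j \<in> {1..m}" for x j by (rule \<phi>_b[OF that])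
    show "\<phi> x l = \<phi> (zero_vert m) l" if "l \<in> {1..n} - b ` {1..m}" for x l
      using that \<phi>_z img by simp
  qed
  moreover have "bij_betw ((`) \<phi>) (cube_edges m) (subcube_edges n i)"
  proof (rule bij_betw_imageI)
    show "inj_on ((`) \<phi>) (cube_edges m)"
    proof (rule inj_onI)
      fix e f assume e: "e \<in> cube_edges m" and f: "f \<in> cube_edges m" and eq: "\<phi> ` e = \<phi> ` f"
      obtain x j where x: "e = cube_edge x j" "x \<in> cube_verts m" "j \<in> {1..m}"
        using e by (auto simp: cube_edges_eq)
      obtain y j' where y: "f = cube_edge y j'" "y \<in> cube_verts m" "j' \<in> {1..m}"
        using f by (auto simp: cube_edges_eq)
      have "b j = b j'" and agree: "\<And>l. l \<noteq> b j \<Longrightarrow> \<phi> x l = \<phi> y l"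
        using eq x y by (simp_all add: \<phi>_edge cube_edge_eq_iff)
      then have "j = j'" using \<beta>_b(1) x y by metis
      moreover have "x l = y l" if "l \<noteq> j" for l
      proof (cases "l \<in> {1..m}")
        case True
        then have "b l \<noteq> b j" using \<beta>_b(1) x(3) that by metis
        then show ?thesis using agree[of "b l"] \<phi>_b[OF True] by simp
      next
        case False
        then show ?thesis using x(2) y(2) cube_verts_outside by metis
      qed
      ultimately show "e = f" using x y by (simp add: cube_edge_eq_iff)
    qed
    show "(`) \<phi> ` cube_edges m = subcube_edges n i"
    proof (intro equalityI subsetI)
      fix f assume "f \<in> (`) \<phi> ` cube_edges m"
      then obtain x j where x: "f = cube_edge (\<phi> x) (b j)" "x \<in> cube_verts m" "j \<in> {1..m}"
        using \<phi>_edge by (auto simp: cube_edges_eq)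
      then show "f \<in> subcube_edges n i"
        using assms i \<phi>_vert \<beta>_b(2) \<phi>_z by (simp add: cube_edge_in_subcube_iff)
    next
      fix f assume "f \<in> subcube_edges n i"
      then obtain x d where x: "f = cube_edge x d" "x \<in> cube_verts n" "d \<in> D"
          "\<forall>l\<in>{1..n} - D. x l = z l"
        using i by (auto simp: subcube_edges_def)
      define y where "y = (\<lambda>l\<in>{1..m}. x (b l))"
      have y: "y \<in> cube_verts m"
        unfolding cube_verts_def
      proof (rule PiE_I)
        fix l assume l: "l \<in> {1..m}"
        then have "b l \<in> {1..n}" using \<beta>_b(2) D by blast
        with x(2) have "x (b l) \<in> {0, 1}" unfolding cube_verts_def by (rule PiE_mem)
        then show "y l \<in> {0, 1}" using l by (simp add: y_def)
      next
        fix l assume "l \<notin> {1..m}"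
        then show "y l = undefined" by (auto simp: y_def)
      qed
      have "\<phi> y = x"
      proof
        fix l show "\<phi> y l = x l"
        proof (cases "l \<in> D")
          case True
          then show ?thesis using b_\<beta>[OF True] by (simp add: \<phi>_def y_def)
        next
          case False
          then show ?thesis
            using x cube_verts_outside[OF x(2)] cube_verts_outside[OF D(3)]
            by (cases "l \<in> {1..n}") (auto simp: \<phi>_z)
        qed
      qed
      then have "f = \<phi> ` cube_edge y (\<beta> d)" using x b_\<beta>[OF x(3)] by (simp add: \<phi>_edge)
      moreover have "cube_edge y (\<beta> d) \<in> cube_edges m"
        using y b_\<beta>(2)[OF x(3)] by (auto simp: cube_edges_eq)
      ultimately show "f \<in> (`) \<phi> ` cube_edges m" by blast
    qed
  qed
  ultimately show ?thesis by (rule that)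
qed

subsection \<open>Extremal entropy and the number of colourings\<close>

lemma finite_templates: "finite (templates k n)"
  unfolding templates_def using finite_cube_edges by (intro finite_PiE) auto

lemma Ent_le_ex_cube:
  assumes "t \<in> templates k n" "realisations n t \<subseteq> P n"
  shows "Ent k n t \<le> ex_cube k P n"
  unfolding ex_cube_def using assms finite_templates by (intro Max_ge) auto

text \<open>The singleton template of any \<open>c \<in> P n\<close> shows that the maximum is over
  a nonempty set.\<close>

lemma ex_cube_attained:
  assumes "P n \<subseteq> colourings k n" "P n \<noteq> {}"
  obtains t where "t \<in> templates k n" "realisations n t \<subseteq> P n" "ex_cube k P n = Ent k n t"
proof -
  obtain c where c: "c \<in> P n" using assms by blast
  define t where "t = (\<lambda>e\<in>cube_edges n. {c e})"
  have cc: "c \<in> cube_edges n \<rightarrow>\<^sub>E {1..k}" using c assms by (auto simp: colourings_def)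
  have "t \<in> templates k n" using cc by (auto simp: t_def templates_def)
  moreover have "realisations n t \<subseteq> P n"
  proof
    fix c' assume c': "c' \<in> realisations n t"
    have "c' = c"
    proof (rule PiE_ext)
      show "c' \<in> Pi\<^sub>E (cube_edges n) t" using c' by (simp add: realisations_def)
      show "c \<in> Pi\<^sub>E (cube_edges n) t" using cc by (auto simp: t_def)
      fix e assume e: "e \<in> cube_edges n"
      then have "c' e \<in> t e" using c' unfolding realisations_def by (rule PiE_mem[rotated])
      then show "c' e = c e" using e by (simp add: t_def)
    qed
    then show "c' \<in> P n" using c by simp
  qed
  ultimately have "{Ent k n t | t. t \<in> templates k n \<and> realisations n t \<subseteq> P n} \<noteq> {}" by blast
  then have "ex_cube k P n \<in> {Ent k n t | t. t \<in> templates k n \<and> realisations n t \<subseteq> P n}"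
    unfolding ex_cube_def using finite_templates by (intro Max_in) auto
  then show ?thesis using that by blast
qed

lemma finite_colourings: "finite (colourings k n)"
  unfolding colourings_def using finite_cube_edges by (intro finite_PiE) auto

lemma card_template_pos:
  assumes "t \<in> templates k n" "e \<in> cube_edges n"
  shows "0 < card (t e)"
proof -
  have "t e \<in> {S. S \<subseteq> {1..k} \<and> S \<noteq> {}}"
    using assms unfolding templates_def by (rule PiE_mem)
  then have "finite (t e)" "t e \<noteq> {}" using finite_subset by auto
  then show ?thesis by (simp add: card_gt_0_iff)
qed

text \<open>The entropy of a template is the logarithm of its number of realisations, and those of
  an admissible template all lie in \<open>P n\<close>.\<close>

lemma ex_cube_bounds:
  assumes "2 \<le> k" "P n \<subseteq> colourings k n" "P n \<noteq> {}"
  shows "0 \<le> ex_cube k P n" "ex_cube k P n \<le> log k (card (P n))"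
proof -
  obtain t where t: "t \<in> templates k n" "realisations n t \<subseteq> P n" "ex_cube k P n = Ent k n t"
    using ex_cube_attained[where P = P and n = n, OF assms(2,3)] by blast
  have k: "1 < real k" using assms by simp
  have pos: "0 < real (card (t e))" if "e \<in> cube_edges n" for e
    using card_template_pos[OF t(1) that] by simp
  have "0 \<le> Ent k n t"
    unfolding Ent_def
  proof (rule sum_nonneg)
    fix e assume "e \<in> cube_edges n"
    then have "1 \<le> real (card (t e))" using card_template_pos[OF t(1)] by (simp add: Suc_leI)
    then show "0 \<le> log k (card (t e))" using k by simp
  qed
  then show "0 \<le> ex_cube k P n" using t by simp
  have "Ent k n t = log k (\<Prod>e\<in>cube_edges n. real (card (t e)))"
    unfolding Ent_def log_def using finite_cube_edges less_imp_neq[OF pos]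
    by (subst ln_prod) (auto simp: sum_divide_distrib)
  also have "(\<Prod>e\<in>cube_edges n. real (card (t e))) = card (realisations n t)"
    unfolding realisations_def using finite_cube_edges by (simp add: card_PiE)
  also have "log k \<dots> \<le> log k (card (P n))"
  proof (rule log_mono[OF k])
    have "0 < (\<Prod>e\<in>cube_edges n. real (card (t e)))" by (rule prod_pos) (use pos in auto)
    also have "\<dots> = card (realisations n t)"
      unfolding realisations_def using finite_cube_edges by (simp add: card_PiE)
    finally show "0 < real (card (realisations n t))" .
    have "finite (P n)" using assms(2) finite_colourings finite_subset by blast
    then show "real (card (realisations n t)) \<le> real (card (P n))"
      using t(2) by (simp add: card_mono)
  qed
  finally show "ex_cube k P n \<le> log k (card (P n))" using t by simp
qed

text \<open>Pulled back along the embedding, \<open>t\<close> becomes a template on the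
  \<open>m\<close>-cube. Each of its realisations is the pullback of some
  \<open>c \<in> P n\<close>, so heredity places it in \<open>P m\<close>. This supplies the
  assumption \<open>local\<close> of \<open>log_card_le_density\<close>.\<close>

lemma subcube_entropy_le:
  assumes hered: "order_hereditary k P" and i: "i \<in> subcubes m n"
    and t: "\<And>e. e \<in> subcube_edges n i \<Longrightarrow> t e \<subseteq> {1..k} \<and> t e \<noteq> {}"
    and realised: "\<And>x. (\<And>e. e \<in> subcube_edges n i \<Longrightarrow> x e \<in> t e) \<Longrightarrow>
      \<exists>c\<in>P n. \<forall>e\<in>subcube_edges n i. c e = x e"
  shows "(\<Sum>e\<in>subcube_edges n i. log k (card (t e))) \<le> ex_cube k P m"
proof -
  obtain \<phi> where \<phi>: "order_embedding m n \<phi>"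
    and bij: "bij_betw ((`) \<phi>) (cube_edges m) (subcube_edges n i)"
    using subcube_embedding[OF i] by blast
  define s where "s = (\<lambda>e\<in>cube_edges m. t (\<phi> ` e))"
  have mem: "\<phi> ` e \<in> subcube_edges n i" if "e \<in> cube_edges m" for e
    using bij that by (auto simp: bij_betw_def)
  have "s \<in> templates k m"
    unfolding templates_def s_def using t mem by auto
  moreover have "realisations m s \<subseteq> P m"
  proof
    fix c' assume c': "c' \<in> realisations m s"
    define x where "x f = c' (the_inv_into (cube_edges m) ((`) \<phi>) f)" for f
    have x: "x (\<phi> ` e) = c' e" if "e \<in> cube_edges m" for e
      using that bij by (simp add: x_def bij_betw_def the_inv_into_f_f)
    have "x f \<in> t f" if "f \<in> subcube_edges n i" for f
    proof -
      have "f \<in> (`) \<phi> ` cube_edges m" using bij that by (simp add: bij_betw_def)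
      then obtain e where e: "f = \<phi> ` e" "e \<in> cube_edges m" by blast
      have "c' e \<in> s e" using c' e(2) unfolding realisations_def by (rule PiE_mem)
      then show ?thesis using x[OF e(2)] e by (simp add: s_def)
    qed
    then obtain c where c: "c \<in> P n" "\<forall>f\<in>subcube_edges n i. c f = x f"
      using realised by blast
    have "pullback m \<phi> c \<in> P m" using hered c(1) \<phi> unfolding order_hereditary_def by blast
    moreover have "pullback m \<phi> c = c'"
    proof
      fix e show "pullback m \<phi> c e = c' e"
      proof (cases "e \<in> cube_edges m")
        case True
        then show ?thesis using c(2) mem x by (simp add: pullback_def)
      next
        case False
        then show ?thesis
          using c' PiE_arb[of c' "cube_edges m" s e] by (simp add: pullback_def realisations_def)
      qed
    qed
    ultimately show "c' \<in> P m" by simp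
  qed
  ultimately have "Ent k m s \<le> ex_cube k P m" by (rule Ent_le_ex_cube)
  moreover have "Ent k m s = (\<Sum>f\<in>subcube_edges n i. log k (card (t f)))"
    unfolding Ent_def by (subst sum.reindex_bij_betw[OF bij, symmetric]) (simp add: s_def)
  ultimately show ?thesis by simp
qed

section \<open>Choice of parameters and passage to the limit\<close>

text \<open>\<open>log_card_le_density\<close> is applied to the \<open>m\<close>-dimensional
  subcubes of the \<open>n\<close>-cube, with parameters that make each of its four error terms at
  most \<open>\<epsilon> / 5\<close> for large \<open>n\<close>.\<close>

lemma log_card_eventually_le:
  fixes \<epsilon> :: real
  assumes k: "2 \<le> k" and hered: "order_hereditary k P" and ne: "\<And>n. P n \<noteq> {}"
    and m: "1 \<le> m" and \<epsilon>: "0 < \<epsilon>"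
  shows "\<forall>\<^sub>F n in sequentially. log k (card (P n)) / (real n * 2 ^ (n - 1))
           \<le> ex_cube k P m / (real m * 2 ^ (m - 1)) + \<epsilon>"
proof -
  define r where "r = card (cube_edges m)"
  define \<rho> where "\<rho> = ex_cube k P m / r"
  \<comment> \<open>Chosen so that \<open>log k (1 / (1 - \<gamma>))\<close> equals
    \<open>\<epsilon> / 5\<close>.\<close>
  define \<gamma> where "\<gamma> = 1 - real k powr (- (\<epsilon> / 5))"
  define \<Lambda> where "\<Lambda> = log k (k / \<gamma>)"
  \<comment> \<open>The first bound guarantees that likely colours exist, the second that the
    unlikely ones cost at most \<open>\<epsilon> / 5\<close>.\<close>
  define \<delta> where "\<delta> = min (1 / k) (\<epsilon> / (5 * k * \<Lambda>))"
  define p where "p = min 1 (\<epsilon> / 5)"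
  define \<theta> where "\<theta> = (\<delta> / 2) ^ (2 * r)"
  \<comment> \<open>This makes \<open>r * u / \<theta>\<close> equal to
    \<open>\<epsilon> / 10\<close>, which leaves room for the term with
    \<open>\<kappa> n\<close>.\<close>
  define u where "u = \<epsilon> * \<theta> / (10 * r)"
  define \<kappa> where "\<kappa> n = real (m - 1) ^ 2 / real (n - 1)" for n
  have P: "P n \<subseteq> colourings k n" for n using hered by (simp add: order_hereditary_def)
  have k1: "1 < real k" using k by simp
  have r: "0 < r" using m by (simp add: r_def card_cube_edges)
  have \<rho>: "0 \<le> \<rho>" using ex_cube_bounds(1)[of k P m] k P ne by (simp add: \<rho>_def)
  have \<gamma>: "0 < \<gamma>" "\<gamma> < 1" using k1 \<epsilon> by (auto simp: \<gamma>_def powr_minus_divide)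
  have \<gamma>_log: "log k (1 / (1 - \<gamma>)) = \<epsilon> / 5" using k1 by (simp add: \<gamma>_def powr_minus_divide)
  have "1 < real k / \<gamma>" using k1 \<gamma> by (simp add: field_simps)
  then have \<Lambda>: "0 < \<Lambda>" using k1 by (simp add: \<Lambda>_def)
  have \<delta>: "0 < \<delta>" using \<Lambda> k1 \<epsilon> by (simp add: \<delta>_def)
  have \<delta>_k: "real k * \<delta> \<le> 1"
    using mult_left_mono[of \<delta> "1 / k" "real k"] k1 by (simp add: \<delta>_def)
  have \<delta>_\<Lambda>: "real k * \<delta> * \<Lambda> \<le> \<epsilon> / 5"
  proof -
    have "\<delta> \<le> \<epsilon> / (5 * k * \<Lambda>)" by (simp add: \<delta>_def)
    then have "\<delta> * (real k * \<Lambda>) \<le> \<epsilon> / (5 * k * \<Lambda>) * (real k * \<Lambda>)"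
      using k1 \<Lambda> by (intro mult_right_mono) auto
    then show ?thesis using k1 \<Lambda> by (simp add: field_simps)
  qed
  have p: "0 < p" "p \<le> 1" "p \<le> \<epsilon> / 5" using \<epsilon> by (auto simp: p_def)
  have \<theta>: "0 < \<theta>" using \<delta> by (simp add: \<theta>_def)
  have u: "0 < u" using \<epsilon> \<theta> r by (simp add: u_def)
  \<comment> \<open>The other parameters depend on \<open>m\<close> and \<open>\<epsilon>\<close>
    but not on \<open>n\<close>, so the overlap term vanishes in the limit.\<close>
  have "\<kappa> \<longlonglongrightarrow> 0"
    unfolding \<kappa>_def
    by (rule tendsto_divide_0[OF tendsto_const] filterlim_at_top_imp_at_infinity
        filterlim_compose[OF filterlim_real_sequentially filterlim_minus_const_nat_at_top])+
  then have "(\<lambda>n. r * (u + \<kappa> n / (p ^ (r - 1) * u)) / \<theta>)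
      \<longlonglongrightarrow> r * (u + 0 / (p ^ (r - 1) * u)) / \<theta>"
    using p u \<theta> by (intro tendsto_intros) auto
  moreover have "r * (u + 0 / (p ^ (r - 1) * u)) / \<theta> < \<epsilon> / 5"
    using r \<theta> \<epsilon> by (simp add: u_def)
  ultimately have "\<forall>\<^sub>F n in sequentially. r * (u + \<kappa> n / (p ^ (r - 1) * u)) / \<theta> < \<epsilon> / 5"
    by (rule order_tendstoD(2))
  moreover have "\<forall>\<^sub>F n in sequentially. max 2 m \<le> n" by (rule eventually_ge_at_top)
  ultimately show ?thesis
  proof eventually_elim
    case (elim n)
    then have n: "2 \<le> n" "m \<le> n" by auto
    interpret colouring_family k "cube_edges n" "P n"
      by unfold_locales (use k finite_cube_edges P ne in \<open>auto simp: colourings_def\<close>)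
    have card_sub: "card (subcube_edges n i) = r" if i: "i \<in> subcubes m n" for i
      using subcube_embedding[OF i] bij_betw_same_card unfolding r_def by metis
    have "log k (card (P n)) \<le> card (cube_edges n) * (\<rho> + p + log k (1 / (1 - \<gamma>))
        + k * \<delta> * log k (k / \<gamma>) + r * (u + \<kappa> n / (p ^ (r - 1) * u)) / (\<delta> / 2) ^ (2 * r))"
    proof (rule log_card_le_density[where I = "subcubes m n" and Q = "subcube_edges n"
          and \<Delta> = "(n - 1) choose (m - 1)"])
      show "(\<Sum>e\<in>subcube_edges n i. log k (card (t e))) \<le> \<rho> * r"
        if "i \<in> subcubes m n" "\<And>e. e \<in> subcube_edges n i \<Longrightarrow> t e \<subseteq> {1..k} \<and> t e \<noteq> {}"
          "\<And>x. (\<And>e. e \<in> subcube_edges n i \<Longrightarrow> x e \<in> t e) \<Longrightarrow>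
            \<exists>c\<in>P n. \<forall>e\<in>subcube_edges n i. c e = x e" for i t
        using subcube_entropy_le[OF hered that] r by (simp add: \<rho>_def)
      show "0 < (n - 1) choose (m - 1)" using n by (simp add: zero_less_binomial_iff)
    qed (use finite_subcubes subcube_edges_subset card_sub card_subcubes_containing_edge[OF _ m]
        card_overlapping_subcubes[OF _ m n(1)] \<rho> p u \<gamma> \<delta> \<delta>_k in \<open>auto simp: \<kappa>_def\<close>)
    also have "\<dots> \<le> card (cube_edges n) * (\<rho> + \<epsilon>)"
    proof (rule mult_left_mono)
      show "\<rho> + p + log k (1 / (1 - \<gamma>)) + k * \<delta> * log k (k / \<gamma>)
          + r * (u + \<kappa> n / (p ^ (r - 1) * u)) / (\<delta> / 2) ^ (2 * r) \<le> \<rho> + \<epsilon>"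
        using p(3) \<gamma>_log \<delta>_\<Lambda> elim(1) \<epsilon>
        unfolding \<Lambda>_def[symmetric] \<theta>_def[symmetric] by linarith
    qed simp
    finally have "log k (card (P n)) \<le> card (cube_edges n) * (\<rho> + \<epsilon>)" .
    moreover have "0 < real (card (cube_edges n))" using n by (simp add: card_cube_edges)
    ultimately have "log k (card (P n)) / card (cube_edges n) \<le> \<rho> + \<epsilon>"
      by (simp add: field_simps)
    then show ?case by (simp add: \<rho>_def r_def card_cube_edges)
  qed
qed

text \<open>The limit is the infimum of \<open>x m\<close> over \<open>m \<ge> 1\<close>. Both
  sequences stay above it from \<open>n = 1\<close> on, and \<open>ev\<close> at a nearly optimal
  \<open>m\<close> forces \<open>a\<close>, and with it \<open>x\<close>, down to it.\<close>

lemma common_limit: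
  fixes a x :: "nat \<Rightarrow> real"
  assumes nonneg: "\<And>n. 1 \<le> n \<Longrightarrow> 0 \<le> x n" and le: "\<And>n. 1 \<le> n \<Longrightarrow> x n \<le> a n"
    and ev: "\<And>m \<epsilon>. 1 \<le> m \<Longrightarrow> 0 < \<epsilon> \<Longrightarrow> \<forall>\<^sub>F n in sequentially. a n \<le> x m + \<epsilon>"
  shows "\<exists>L. x \<longlonglongrightarrow> L \<and> a \<longlonglongrightarrow> L"
proof -
  define L where "L = (INF m\<in>{1..}. x m)"
  have bdd: "bdd_below (x ` {1..})" using nonneg by (auto intro: bdd_belowI[of _ 0])
  have L_le: "L \<le> x n" if "1 \<le> n" for n
    unfolding L_def using bdd that by (intro cINF_lower) auto
  have a_less: "\<forall>\<^sub>F n in sequentially. a n < y" if "L < y" for y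
  proof -
    obtain m where m: "1 \<le> m" "x m < y"
      using \<open>L < y\<close> bdd unfolding L_def by (subst (asm) cINF_less_iff) auto
    have "\<forall>\<^sub>F n in sequentially. a n \<le> x m + (y - x m) / 2"
      using m by (intro ev) auto
    then show ?thesis by (rule eventually_mono) (use m in \<open>auto simp: field_simps\<close>)
  qed
  have ge1: "\<forall>\<^sub>F n in sequentially. (1::nat) \<le> n" by (rule eventually_ge_at_top)
  have "x \<longlonglongrightarrow> L"
  proof (rule order_tendstoI)
    show "\<forall>\<^sub>F n in sequentially. y < x n" if "y < L" for y
      using ge1 by (rule eventually_mono) (use L_le that in force)
    show "\<forall>\<^sub>F n in sequentially. x n < y" if "L < y" for y
      using ge1 a_less[OF that] by eventually_elim (use le in force)
  qed
  moreover have "a \<longlonglongrightarrow> L"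
  proof (rule order_tendstoI)
    show "\<forall>\<^sub>F n in sequentially. y < a n" if "y < L" for y
      using ge1 by (rule eventually_mono) (use L_le le that in force)
  qed (rule a_less)
  ultimately show ?thesis by blast
qed

theorem corollary3p16:
  fixes k :: nat and P :: "nat \<Rightarrow> colouring set"
  assumes "k \<ge> 2"
    and "order_hereditary k P"
    and "\<And>n. P n \<noteq> {}"
  shows "\<exists>\<epsilon> :: nat \<Rightarrow> real. \<epsilon> \<in> o(\<lambda>_. 1) \<and>
           (\<forall>n. real (card (P n)) = real k powr ((cube_density k P + \<epsilon> n) * (2 ^ (n - 1) * real n)))"
proof -
  define x where "x n = ex_cube k P n / (real n * 2 ^ (n - 1))" for n
  define a where "a n = log k (card (P n)) / (real n * 2 ^ (n - 1))" for n
  have P: "P n \<subseteq> colourings k n" for n using assms(2) by (simp add: order_hereditary_def)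
  have bounds: "0 \<le> ex_cube k P n" "ex_cube k P n \<le> log k (card (P n))" for n
    using ex_cube_bounds[of k P n] assms P by auto
  have "\<exists>L. x \<longlonglongrightarrow> L \<and> a \<longlonglongrightarrow> L"
  proof (rule common_limit)
    show "0 \<le> x n" for n using bounds by (simp add: x_def)
    show "x n \<le> a n" for n unfolding x_def a_def using bounds by (intro divide_right_mono) auto
    show "\<forall>\<^sub>F n in sequentially. a n \<le> x m + \<epsilon>" if "1 \<le> m" "0 < \<epsilon>" for m \<epsilon>
      unfolding a_def x_def by (rule log_card_eventually_le[OF assms that])
  qed
  then obtain L where L: "x \<longlonglongrightarrow> L" "a \<longlonglongrightarrow> L" by blast
  have density: "cube_density k P = L"
    unfolding cube_density_def x_def[symmetric] by (rule limI[OF L(1)])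
  have "(\<lambda>n. a n - L) \<longlonglongrightarrow> 0" using L(2) by (simp add: LIM_zero)
  then have "(\<lambda>n. a n - L) \<in> o(\<lambda>_. 1)" by (intro smalloI_tendsto) auto
  \<comment> \<open>The error sequence is \<open>a n - L\<close>, which makes the formula exact. At
    \<open>n = 0\<close> the exponent vanishes, and a cube without edges has exactly one
    colouring.\<close>
  moreover have "real (card (P n)) = real k powr ((L + (a n - L)) * (2 ^ (n - 1) * real n))" for n
  proof (cases "n = 0")
    case True
    have "card (P 0) = 1"
    proof -
      have "P 0 \<subseteq> {\<lambda>_. undefined}" using P[of 0] by (simp add: colourings_def cube_edges_eq)
      then have "P 0 = {\<lambda>_. undefined}" using assms(3) by blast
      then show ?thesis by simp
    qed
    then show ?thesis using True assms(1) by simp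
  next
    case False
    have "finite (P n)" using P finite_colourings finite_subset by blast
    then have "0 < real (card (P n))" using assms(3) by (simp add: card_gt_0_iff)
    moreover have "(L + (a n - L)) * (2 ^ (n - 1) * real n) = log k (card (P n))"
      using False by (simp add: a_def)
    ultimately show ?thesis using assms(1) by simp
  qed
  ultimately show ?thesis unfolding density by blast
qed

end
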